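(* Let $L$ be an even positive definite lattice of rank $l$ and $M=2U\oplus L$. For every integer $k\ge1$, $$\dim\mathbf{FM}_k(\widetilde{\mathrm O}^+(M))\le\sum_{m=0}^{[k/\varrho_L]}\dim J^{\widetilde{\mathrm O}(L)}_{k,L,m}[q^m],$$ where $[x]$ is the integer part of $x$. In particular $\dim\mathbf{FM}_k(\widetilde{\mathrm O}^+(M))<\infty$. Moreover there is a constant $c_L>0$ depending only on $L$ such that $\dim\mathbf{FM}_k(\widetilde{\mathrm O}^+(M))\le c_L\,k^{l+2}$ for all $k\ge1$.
   Context: $L$ has form $\langle\cdot,\cdot\rangle$, dual $L'$; $U$ is the even unimodular lattice of signature $(1,1)$. $J_{k,L,m}$ is the space of holomorphic Jacobi forms of weight $k$, index $m$, trivial character on $\mathrm{SL}_2(\mathbb Z)$ for $L$: holomorphic $\varphi$ on $\mathbb H\times(L\otimes\mathbb C)$ with $(c\tau+d)^{-k}e^{-\pi im\frac{c\langle\mathfrak z,\mathfrak z\rangle}{c\tau+d}}\varphi(\frac{a\tau+b}{c\tau+d},\frac{\mathfrak z}{c\tau+d})=\varphi(\tau,\mathfrak z)$ for $\begin{pmatrix}a&b\\c&d\end{pmatrix}\in\mathrm{SL}_2(\mathbb Z)$, $e^{\pi im(\langle x,x\rangle\tau+2\langle x,\mathfrak z\rangle)}\varphi(\tau,\mathfrak z+x\tau+y)=\varphi(\tau,\mathfrak z)$ for $x,y\in L$, and $\varphi=\sum_{n\in\mathbb N,\ell\in L'}f(n,\ell)q^n\zeta^\ell$ ($q=e^{2\pi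 i\tau}$, $\zeta^\ell=e^{2\pi i\langle\ell,\mathfrak z\rangle}$) with $f(n,\ell)=0$ unless $2nm\ge\langle\ell,\ell\rangle$. $\widetilde{\mathrm O}(L)=\{g\in\mathrm O(L):g(v)-v\in L\ \forall v\in L'\}$ acts on $\mathfrak z$; $J^{\widetilde{\mathrm O}(L)}_{k,L,m}$ is the invariant subspace, and $J^{\widetilde{\mathrm O}(L)}_{k,L,m}[q^N]$ its subspace of forms whose Fourier coefficients vanish for $n<N$. A symmetric formal Fourier–Jacobi series of weight $k$ on $\widetilde{\mathrm O}^+(M)$ is a formal series $\Psi=\sum_{m\ge0}\psi_m(\tau,\mathfrak z)\xi^m$ with $\psi_m=\sum f_m(n,\ell)q^n\zeta^\ell\in J^{\widetilde{\mathrm O}(L)}_{k,L,m}$ and $f_m(n,\ell)=f_n(m,\ell)$ for all $m,n,\ell$; their space is $\mathbf{FM}_k(\widetilde{\mathrm O}^+(M))$. For $\Psi\ne0$, $\mathrm{ord}(\Psi)=\min\{m:\psi_m\neq0\}$, $\varrho(\Psi)=k/\mathrm{ord}(\Psi)$, and $\varrho_L=\inf\{\varrho(\Psi):\Psi\ne0\text{ of some weight }k\ge1\}$ (which is positive). *)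

theory Defs
  imports "HOL-Analysis.Analysis" "HOL-Library.Function_Algebras"
begin

section \<open>Even positive definite lattices\<close>

text \<open>
  A positive definite lattice of rank \<open>l = CARD('n)\<close> is realised inside the Euclidean space
  \<open>L \<otimes> \<real> = real ^ 'n\<close>, its bilinear form being the inner product \<open>\<bullet>\<close>; correspondingly
  \<open>L \<otimes> \<complex> = complex ^ 'n\<close>, with the complex bilinear (not Hermitian) extension \<open>cdot\<close> of the form.
\<close>

definition full_lattice :: "(real ^ 'n) set \<Rightarrow> bool" where
  "full_lattice L \<longleftrightarrow>
     (\<exists>B. independent B \<and> span B = UNIV \<and>
          L = {\<Sum>b\<in>B. of_int (a b) *\<^sub>R b | a :: real ^ 'n \<Rightarrow> int. True})"

definition even_lattice :: "(real ^ 'n) set \<Rightarrow> bool" where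
  "even_lattice L \<longleftrightarrow> full_lattice L \<and> (\<forall>x\<in>L. \<exists>j :: int. x \<bullet> x = 2 * of_int j)"

definition dual_lattice :: "(real ^ 'n) set \<Rightarrow> (real ^ 'n) set" where
  "dual_lattice L = {v. \<forall>x\<in>L. v \<bullet> x \<in> \<int>}"

definition cdot :: "complex ^ 'n \<Rightarrow> complex ^ 'n \<Rightarrow> complex" where
  "cdot z w = (\<Sum>i\<in>UNIV. z $ i * w $ i)"

definition cvec :: "real ^ 'n \<Rightarrow> complex ^ 'n" where
  "cvec x = (\<chi> i. of_real (x $ i))"

definition cmat :: "real ^ 'n ^ 'n \<Rightarrow> complex ^ 'n ^ 'n" where
  "cmat A = (\<chi> i j. of_real (A $ i $ j))"

text \<open>
  An isometry of \<open>L\<close> extends uniquely to \<open>L \<otimes> \<real>\<close>, and is represented by the matrix of this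
  extension.
\<close>

definition lattice_isometries :: "(real ^ 'n) set \<Rightarrow> (real ^ 'n ^ 'n) set" where
  "lattice_isometries L = {A. orthogonal_matrix A \<and> (\<lambda>v. A *v v) ` L = L}"

definition discriminant_kernel :: "(real ^ 'n) set \<Rightarrow> (real ^ 'n ^ 'n) set" where
  "discriminant_kernel L =
     {A \<in> lattice_isometries L. \<forall>v\<in>dual_lattice L. A *v v - v \<in> L}"


section \<open>Jacobi forms\<close>

definition upper_half_plane :: "complex set" where
  "upper_half_plane = {\<tau>. Im \<tau> > 0}"

text \<open>
  Holomorphy in several variables: complex Frechet differentiability, where
  \<open>(t, w) \<mapsto> a * t + cdot b w\<close> is the general complex linear form on \<open>complex \<times> (complex ^ 'n)\<close>.
\<close>

definition holomorphic_jac :: "(complex \<times> (complex ^ 'n) \<Rightarrow> complex) \<Rightarrow> bool" where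
  "holomorphic_jac \<phi> \<longleftrightarrow>
     (\<forall>\<tau>\<in>upper_half_plane. \<forall>z. \<exists>a b.
        (\<phi> has_derivative (\<lambda>(t, w). a * t + cdot b w)) (at (\<tau>, z)))"

text \<open>
  \<open>fourier_expansion L m \<phi> f\<close>: \<open>f\<close> is the family of Fourier coefficients of \<open>\<phi>\<close>, and satisfies the
  condition for a holomorphic Jacobi form of index \<open>m\<close>.  The family is extended by zero off the
  dual lattice.
\<close>

definition fourier_expansion ::
    "(real ^ 'n) set \<Rightarrow> nat \<Rightarrow> (complex \<times> (complex ^ 'n) \<Rightarrow> complex) \<Rightarrow>
     (nat \<Rightarrow> real ^ 'n \<Rightarrow> complex) \<Rightarrow> bool" where
  "fourier_expansion L m \<phi> f \<longleftrightarrow>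
     (\<forall>n l. l \<notin> dual_lattice L \<longrightarrow> f n l = 0) \<and>
     (\<forall>n l. \<not> 2 * real n * real m \<ge> l \<bullet> l \<longrightarrow> f n l = 0) \<and>
     (\<forall>\<tau>\<in>upper_half_plane. \<forall>z.
        ((\<lambda>(n, l). f n l * exp (2 * pi * \<i> * \<tau>) ^ n * exp (2 * pi * \<i> * cdot (cvec l) z))
           has_sum \<phi> (\<tau>, z)) (UNIV \<times> dual_lattice L))"

text \<open>
  A function on \<open>upper_half_plane \<times> UNIV\<close> is represented by its extension by zero, so that distinct
  elements of the set below are distinct as functions on that domain.
\<close>

definition jacobi_forms ::
    "nat \<Rightarrow> (real ^ 'n) set \<Rightarrow> nat \<Rightarrow> (complex \<times> (complex ^ 'n) \<Rightarrow> complex) set" where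
  "jacobi_forms k L m = {\<phi>.
     (\<forall>\<tau> z. \<tau> \<notin> upper_half_plane \<longrightarrow> \<phi> (\<tau>, z) = 0) \<and>
     holomorphic_jac \<phi> \<and>
     (\<forall>a b c d :: int. a * d - b * c = 1 \<longrightarrow> (\<forall>\<tau>\<in>upper_half_plane. \<forall>z.
        (of_int c * \<tau> + of_int d) powi (- int k) *
        exp (- (pi * \<i> * of_nat m * (of_int c * cdot z z / (of_int c * \<tau> + of_int d)))) *
        \<phi> ((of_int a * \<tau> + of_int b) / (of_int c * \<tau> + of_int d),
           (1 / (of_int c * \<tau> + of_int d)) *s z) = \<phi> (\<tau>, z))) \<and>
     (\<forall>x\<in>L. \<forall>y\<in>L. \<forall>\<tau>\<in>upper_half_plane. \<forall>z.
        exp (pi * \<i> * of_nat m * (of_real (x \<bullet> x) * \<tau> + 2 * cdot (cvec x) z)) *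
        \<phi> (\<tau>, z + \<tau> *s cvec x + cvec y) = \<phi> (\<tau>, z)) \<and>
     (\<exists>f. fourier_expansion L m \<phi> f)}"

definition jacobi_forms_inv ::
    "nat \<Rightarrow> (real ^ 'n) set \<Rightarrow> nat \<Rightarrow> (complex \<times> (complex ^ 'n) \<Rightarrow> complex) set" where
  "jacobi_forms_inv k L m = {\<phi> \<in> jacobi_forms k L m.
     \<forall>A\<in>discriminant_kernel L. \<forall>\<tau>\<in>upper_half_plane. \<forall>z. \<phi> (\<tau>, cmat A *v z) = \<phi> (\<tau>, z)}"

definition jacobi_forms_inv_vanish ::
    "nat \<Rightarrow> (real ^ 'n) set \<Rightarrow> nat \<Rightarrow> nat \<Rightarrow> (complex \<times> (complex ^ 'n) \<Rightarrow> complex) set" where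
  "jacobi_forms_inv_vanish k L m N = {\<phi> \<in> jacobi_forms_inv k L m.
     \<exists>f. fourier_expansion L m \<phi> f \<and> (\<forall>n<N. \<forall>l. f n l = 0)}"


section \<open>Symmetric formal Fourier--Jacobi series\<close>

text \<open>The formal series \<open>\<Sum>m. \<psi>\<^sub>m \<xi>\<^sup>m\<close> is the sequence of its coefficients.\<close>

definition formal_FJ ::
    "nat \<Rightarrow> (real ^ 'n) set \<Rightarrow> (nat \<Rightarrow> complex \<times> (complex ^ 'n) \<Rightarrow> complex) set" where
  "formal_FJ k L = {\<Psi>.
     (\<forall>m. \<Psi> m \<in> jacobi_forms_inv k L m) \<and>
     (\<exists>f. (\<forall>m. fourier_expansion L m (\<Psi> m) (f m)) \<and> (\<forall>m n l. f m n l = f n m l))}"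

definition FJ_ord :: "(nat \<Rightarrow> complex \<times> (complex ^ 'n) \<Rightarrow> complex) \<Rightarrow> nat" where
  "FJ_ord \<Psi> = (LEAST m. \<Psi> m \<noteq> 0)"

text \<open>
  The slope is computed in the extended reals, where \<open>k / 0 = \<infinity>\<close> for \<open>k > 0\<close>; hence series of
  order \<open>0\<close> do not contribute to the infimum.
\<close>

definition slope_bound :: "(real ^ 'n) set \<Rightarrow> ereal" where
  "slope_bound L =
     (INF (k, \<Psi>) \<in> {(k, \<Psi>). 1 \<le> k \<and> \<Psi> \<in> formal_FJ k L \<and> \<Psi> \<noteq> 0}.
        ereal (real k) / ereal (real (FJ_ord \<Psi>)))"


section \<open>Dimensions\<close>

text \<open>
  The library dimension of an infinite-dimensional space is \<open>0\<close>; here it is \<open>\<infinity>\<close>.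
\<close>

definition edim :: "(complex \<Rightarrow> 'v::ab_group_add \<Rightarrow> 'v) \<Rightarrow> 'v set \<Rightarrow> enat" where
  "edim scl V = (if \<exists>B. finite B \<and> V \<subseteq> module.span scl B
                 then enat (vector_space.dim scl V) else \<infinity>)"

definition scale_fun :: "complex \<Rightarrow> ('x \<Rightarrow> complex) \<Rightarrow> 'x \<Rightarrow> complex" where
  "scale_fun c \<phi> = (\<lambda>p. c * \<phi> p)"

definition scale_seq :: "complex \<Rightarrow> (nat \<Rightarrow> 'x \<Rightarrow> complex) \<Rightarrow> nat \<Rightarrow> 'x \<Rightarrow> complex" where
  "scale_seq c \<Psi> = (\<lambda>m. scale_fun c (\<Psi> m))"

lemma vector_space_scale_fun: "vector_space scale_fun"
  by unfold_locales (auto simp: scale_fun_def fun_eq_iff algebra_simps)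

lemma vector_space_scale_seq: "vector_space scale_seq"
  by unfold_locales (auto simp: scale_seq_def scale_fun_def fun_eq_iff algebra_simps)

lemma fourier_expansion_lincomb:
  assumes "fourier_expansion L m \<phi> f" "fourier_expansion L m \<psi> g"
  shows "fourier_expansion L m (scale_fun c \<phi> + \<psi>) (\<lambda>n l. c * f n l + g n l)"
proof -
  have "((\<lambda>(n, l). (c * f n l + g n l) * exp (2 * pi * \<i> * \<tau>) ^ n
            * exp (2 * pi * \<i> * cdot (cvec l) z))
           has_sum (scale_fun c \<phi> + \<psi>) (\<tau>, z)) (UNIV \<times> dual_lattice L)"
    if "\<tau> \<in> upper_half_plane" for \<tau> z
  proof -
    let ?e = "\<lambda>n l. exp (2 * pi * \<i> * \<tau>) ^ n * exp (2 * pi * \<i> * cdot (cvec l) z)"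
    have F: "((\<lambda>(n, l). f n l * ?e n l) has_sum \<phi> (\<tau>, z)) (UNIV \<times> dual_lattice L)"
      and G: "((\<lambda>(n, l). g n l * ?e n l) has_sum \<psi> (\<tau>, z)) (UNIV \<times> dual_lattice L)"
      using assms that by (auto simp: fourier_expansion_def mult.assoc)
    show ?thesis
      using has_sum_add[OF has_sum_cmult_right[OF F, of c] G]
      by (simp add: scale_fun_def case_prod_unfold algebra_simps)
  qed
  then show ?thesis
    using assms by (auto simp: fourier_expansion_def)
qed

lemma fourier_expansion_zero: "fourier_expansion L m 0 (\<lambda>n l. 0)"
  by (auto simp: fourier_expansion_def case_prod_unfold)

lemma holomorphic_jac_lincomb:
  assumes "holomorphic_jac \<phi>" "holomorphic_jac \<psi>"
  shows "holomorphic_jac (scale_fun c \<phi> + \<psi>)"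
  unfolding holomorphic_jac_def
proof (intro ballI allI)
  fix \<tau> z assume \<tau>: "\<tau> \<in> upper_half_plane"
  obtain a b where 1: "(\<phi> has_derivative (\<lambda>(t, w). a * t + cdot b w)) (at (\<tau>, z))"
    using assms(1)[unfolded holomorphic_jac_def, rule_format, OF \<tau>, of z] by blast
  obtain a' b' where 2: "(\<psi> has_derivative (\<lambda>(t, w). a' * t + cdot b' w)) (at (\<tau>, z))"
    using assms(2)[unfolded holomorphic_jac_def, rule_format, OF \<tau>, of z] by blast
  have "((\<lambda>p. c * \<phi> p + \<psi> p) has_derivative
         (\<lambda>p. c * (case p of (t, w) \<Rightarrow> a * t + cdot b w)
              + (case p of (t, w) \<Rightarrow> a' * t + cdot b' w))) (at (\<tau>, z))"
    by (intro derivative_intros 1 2 has_derivative_mult_right)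
  moreover have "(\<lambda>p. c * (case p of (t, w) \<Rightarrow> a * t + cdot b w)
              + (case p of (t, w) \<Rightarrow> a' * t + cdot b' w))
       = (\<lambda>(t, w). (c * a + a') * t + cdot (c *s b + b') w)"
    by (auto simp: fun_eq_iff cdot_def algebra_simps sum.distrib sum_distrib_left)
  ultimately show "\<exists>a b. ((scale_fun c \<phi> + \<psi>) has_derivative
      (\<lambda>(t, w). a * t + cdot b w)) (at (\<tau>, z))"
    by (auto simp: scale_fun_def plus_fun_def)
qed

lemma holomorphic_jac_zero: "holomorphic_jac 0"
  unfolding holomorphic_jac_def
proof (intro ballI allI)
  fix \<tau> :: complex and z :: "complex ^ 'n"
  have "((\<lambda>p. 0) has_derivative (\<lambda>(t, w). 0 * t + cdot 0 w)) (at (\<tau>, z))"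
    by (simp add: cdot_def case_prod_unfold)
  then show "\<exists>a b. (0 has_derivative (\<lambda>(t, w). a * t + cdot b w)) (at (\<tau>, z))"
    unfolding zero_fun_def by blast
qed

lemma jacobi_forms_lincomb:
  assumes "\<phi> \<in> jacobi_forms k L m" "\<psi> \<in> jacobi_forms k L m"
  shows "scale_fun c \<phi> + \<psi> \<in> jacobi_forms k L m"
proof -
  have eq: "u * v * (scale_fun c \<phi> + \<psi>) p = (scale_fun c \<phi> + \<psi>) p'"
    if "u * v * \<phi> p = \<phi> p'" "u * v * \<psi> p = \<psi> p'" for u v p p'
  proof -
    have "u * v * (scale_fun c \<phi> + \<psi>) p = c * (u * v * \<phi> p) + u * v * \<psi> p"
      by (simp add: scale_fun_def algebra_simps)
    then show ?thesis using that by (simp add: scale_fun_def)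
  qed
  have eq1: "u * (scale_fun c \<phi> + \<psi>) p = (scale_fun c \<phi> + \<psi>) p'"
    if "u * \<phi> p = \<phi> p'" "u * \<psi> p = \<psi> p'" for u p p'
    using eq[of 1 u p p'] that by simp
  note A = assms(1)[unfolded jacobi_forms_def mem_Collect_eq]
  note B = assms(2)[unfolded jacobi_forms_def mem_Collect_eq]
  note A1 = A[THEN conjunct1] and A2 = A[THEN conjunct2, THEN conjunct1]
    and A3 = A[THEN conjunct2, THEN conjunct2, THEN conjunct1]
    and A4 = A[THEN conjunct2, THEN conjunct2, THEN conjunct2, THEN conjunct1]
    and A5 = A[THEN conjunct2, THEN conjunct2, THEN conjunct2, THEN conjunct2]
  note B1 = B[THEN conjunct1] and B2 = B[THEN conjunct2, THEN conjunct1]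
    and B3 = B[THEN conjunct2, THEN conjunct2, THEN conjunct1]
    and B4 = B[THEN conjunct2, THEN conjunct2, THEN conjunct2, THEN conjunct1]
    and B5 = B[THEN conjunct2, THEN conjunct2, THEN conjunct2, THEN conjunct2]
  obtain f g where fg: "fourier_expansion L m \<phi> f" "fourier_expansion L m \<psi> g"
    using A5 B5 by metis
  show ?thesis
    unfolding jacobi_forms_def mem_Collect_eq
  proof (intro conjI)
    show "\<forall>\<tau> z. \<tau> \<notin> upper_half_plane \<longrightarrow> (scale_fun c \<phi> + \<psi>) (\<tau>, z) = 0"
      using A1 B1 by (simp add: scale_fun_def)
    show "holomorphic_jac (scale_fun c \<phi> + \<psi>)"
      by (rule holomorphic_jac_lincomb[OF A2 B2])
    show "\<exists>f. fourier_expansion L m (scale_fun c \<phi> + \<psi>) f"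
      using fourier_expansion_lincomb[OF fg] by blast
  qed (intro allI impI ballI,
      (rule eq[OF A3[rule_format] B3[rule_format]] eq1[OF A4[rule_format] B4[rule_format]];
        assumption))+
qed

lemma jacobi_forms_zero: "0 \<in> jacobi_forms k L m"
  using fourier_expansion_zero holomorphic_jac_zero by (auto simp: jacobi_forms_def)

lemma jacobi_forms_inv_lincomb:
  assumes "\<phi> \<in> jacobi_forms_inv k L m" "\<psi> \<in> jacobi_forms_inv k L m"
  shows "scale_fun c \<phi> + \<psi> \<in> jacobi_forms_inv k L m"
  using assms jacobi_forms_lincomb by (auto simp: jacobi_forms_inv_def scale_fun_def)

lemma jacobi_forms_inv_zero: "0 \<in> jacobi_forms_inv k L m"
  using jacobi_forms_zero by (auto simp: jacobi_forms_inv_def)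

lemma subspace_of_lincomb:
  assumes "vector_space scl" "0 \<in> V" "\<And>c x y. x \<in> V \<Longrightarrow> y \<in> V \<Longrightarrow> scl c x + y \<in> V"
  shows "module.subspace scl V"
proof -
  interpret vector_space scl by fact
  show ?thesis
    using assms(2) assms(3)[of _ _ 1] assms(3)[of _ 0] by (auto simp: subspace_def)
qed

lemma subspace_jacobi_forms_inv_vanish:
  "module.subspace scale_fun (jacobi_forms_inv_vanish k L m N)"
proof (rule subspace_of_lincomb[OF vector_space_scale_fun])
  show "0 \<in> jacobi_forms_inv_vanish k L m N"
    using jacobi_forms_inv_zero fourier_expansion_zero
    by (fastforce simp: jacobi_forms_inv_vanish_def)
  fix c \<phi> \<psi>
  assume 1: "\<phi> \<in> jacobi_forms_inv_vanish k L m N" and 2: "\<psi> \<in> jacobi_forms_inv_vanish k L m N"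
  obtain f where f: "fourier_expansion L m \<phi> f" "\<forall>n<N. \<forall>l. f n l = 0"
    using 1 by (auto simp: jacobi_forms_inv_vanish_def)
  obtain g where g: "fourier_expansion L m \<psi> g" "\<forall>n<N. \<forall>l. g n l = 0"
    using 2 by (auto simp: jacobi_forms_inv_vanish_def)
  have "\<exists>h. fourier_expansion L m (scale_fun c \<phi> + \<psi>) h \<and> (\<forall>n<N. \<forall>l. h n l = 0)"
    using fourier_expansion_lincomb[OF f(1) g(1), of c] f(2) g(2)
    by (intro exI[of _ "\<lambda>n l. c * f n l + g n l"]) auto
  then show "scale_fun c \<phi> + \<psi> \<in> jacobi_forms_inv_vanish k L m N"
    using 1 2 jacobi_forms_inv_lincomb by (auto simp: jacobi_forms_inv_vanish_def)
qed

lemma subspace_formal_FJ: "module.subspace scale_seq (formal_FJ k L)"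
proof (rule subspace_of_lincomb[OF vector_space_scale_seq])
  have "\<exists>f. (\<forall>m. fourier_expansion L m 0 (f m)) \<and> (\<forall>m n l. f m n l = f n m l)"
    by (rule exI[of _ "\<lambda>m n l. 0"]) (simp add: fourier_expansion_zero)
  then show "0 \<in> formal_FJ k L"
    using jacobi_forms_inv_zero by (auto simp: formal_FJ_def)
  fix c \<Phi> \<Psi>
  assume 1: "\<Phi> \<in> formal_FJ k L" and 2: "\<Psi> \<in> formal_FJ k L"
  obtain f where f: "\<And>m. fourier_expansion L m (\<Phi> m) (f m)" "\<And>m n l. f m n l = f n m l"
    using 1 by (auto simp: formal_FJ_def)
  obtain g where g: "\<And>m. fourier_expansion L m (\<Psi> m) (g m)" "\<And>m n l. g m n l = g n m l"
    using 2 by (auto simp: formal_FJ_def)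
  have "(\<forall>m. fourier_expansion L m ((scale_seq c \<Phi> + \<Psi>) m) (\<lambda>n l. c * f m n l + g m n l))"
    using fourier_expansion_lincomb[OF f(1) g(1)] by (simp add: scale_seq_def)
  moreover have "\<forall>m n l. c * f m n l + g m n l = c * f n m l + g n m l"
    using f(2) g(2) by metis
  ultimately have "\<exists>h. (\<forall>m. fourier_expansion L m ((scale_seq c \<Phi> + \<Psi>) m) (h m)) \<and>
      (\<forall>m n l. h m n l = h n m l)"
    by (intro exI[of _ "\<lambda>m n l. c * f m n l + g m n l"]) auto
  moreover have "(scale_seq c \<Phi> + \<Psi>) m \<in> jacobi_forms_inv k L m" for m
    using jacobi_forms_inv_lincomb[of "\<Phi> m" k L m "\<Psi> m" c] 1 2
    by (simp add: formal_FJ_def scale_seq_def)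
  ultimately show "scale_seq c \<Phi> + \<Psi> \<in> formal_FJ k L"
    by (simp add: formal_FJ_def)
qed

end

theory Submission
  imports Defs "HOL-Complex_Analysis.Complex_Analysis"
begin

text \<open>
  The heart of the matter is a vanishing theorem: a Jacobi form of weight \<open>k\<close> and index \<open>m\<close> whose
  Fourier coefficients vanish for \<open>n < R\<close> is zero as soon as \<open>R \<ge> m\<close> and \<open>R > C * k\<close>, with
  \<open>C\<close> depending only on \<open>L\<close>. In coordinates \<open>z = a * \<tau> + b\<close> with \<open>a, b\<close> real, the function
  \<open>Phi \<tau> a b = exp (\<pi> i m a\<^sup>2 \<tau>) \<phi>(\<tau>, a \<tau> + b)\<close> is invariant up to unitary factors under
  translation of \<open>(a, b)\<close> by \<open>L \<times> L\<close>, and \<open>SL\<^sub>2(\<int>)\<close> acts on it with weight \<open>k\<close>, moving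
  \<open>(a, b)\<close> linearly. It decays like \<open>q\<^bsup>R/4\<^esup>\<close> at the cusp only for \<open>a\<close> close to \<open>L\<close>,
  so one passes to the product of its translates (\<open>Phi_prod\<close>) by the finite group \<open>(1/N)L / L\<close> in both
  variables, for a fixed fine \<open>N\<close>; this has weight proportional to \<open>k\<close> and decays uniformly in
  \<open>(a, b)\<close>. Comparing the maximum of the invariant \<open>\<bar>Phi_prod\<bar>\<^sup>2 y\<^bsup>weight\<^esup>\<close> with the maximum
  principle for \<open>Phi_prod\<close> on a half plane then bounds \<open>R\<close> linearly in \<open>k\<close>.

  By symmetry, the first nonzero coefficient \<open>\<psi>\<^sub>m\<close> of a symmetric series lies in the space of Jacobi
  forms vanishing to order \<open>m\<close>, so the vanishing theorem gives \<open>m \<le> C * k\<close>. Hence the slope bound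
  is positive, and filtering by order gives the first inequality. The vanishing theorem also shows that a
  series is determined by its coefficients \<open>f\<^sub>m(n, l)\<close> with \<open>m, n \<le> C * k\<close> and
  \<open>\<langle>l, l\<rangle> \<le> 2 m n\<close>, of which there are \<open>O(k\<^bsup>rank L + 2\<^esup>)\<close>.
\<close>

section \<open>Dimensions\<close>

lemma edim_le_card:
  assumes "vector_space scl" "finite B" "V \<subseteq> module.span scl B"
  shows "edim scl V \<le> enat (card B)"
proof -
  interpret vector_space scl by fact
  show ?thesis
    using dim_le_card[OF assms(3,2)] assms(2,3) by (auto simp: edim_def)
qed

lemma edim_finite_basis:
  assumes "vector_space scl" "edim scl V \<noteq> \<infinity>"
  obtains B where "finite B" "B \<subseteq> V" "V \<subseteq> module.span scl B" "edim scl V = enat (card B)"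
proof -
  interpret vector_space scl by fact
  obtain C where C: "finite C" "V \<subseteq> span C"
    using assms(2) by (auto simp: edim_def split: if_splits)
  then have dimV: "edim scl V = enat (dim V)" by (auto simp: edim_def)
  obtain B where B: "B \<subseteq> V" "independent B" "V \<subseteq> span B" "card B = dim V"
    using basis_exists by blast
  have "finite B"
    using independent_span_bound[OF C(1) B(2)] B(1) C(2) by auto
  then show ?thesis using that B dimV by simp
qed

lemma edim_mono:
  assumes "vector_space scl" "V \<subseteq> W"
  shows "edim scl V \<le> edim scl W"
proof (cases "edim scl W = \<infinity>")
  case False
  then obtain B where "finite B" "W \<subseteq> module.span scl B" "edim scl W = enat (card B)"
    using edim_finite_basis[OF assms(1)] by metis
  then show ?thesis using edim_le_card[OF assms(1), of B V] assms(2) by auto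
qed auto

lemma edim_zero:
  assumes "vector_space scl" "V \<subseteq> {0}"
  shows "edim scl V = 0"
proof -
  interpret vector_space scl by fact
  show ?thesis using edim_le_card[OF assms(1), of "{}" V] assms(2) by (simp flip: zero_enat_def)
qed

text \<open>Rank-nullity as an inequality: a spanning set of the kernel together with preimages of a
  basis of the image spans \<open>V\<close>. If a summand is infinite there is nothing to
  show.\<close>

lemma edim_le_kernel:
  fixes s1 :: "complex \<Rightarrow> 'u::ab_group_add \<Rightarrow> 'u" and s2 :: "complex \<Rightarrow> 'v::ab_group_add \<Rightarrow> 'v"
  assumes vs1: "vector_space s1" and vs2: "vector_space s2"
    and V: "module.subspace s1 V"
    and g: "\<And>c x y. x \<in> V \<Longrightarrow> y \<in> V \<Longrightarrow> g (s1 c x + y) = s2 c (g x) + g y"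
    and U: "g ` V \<subseteq> U"
  shows "edim s1 V \<le> edim s1 {x\<in>V. g x = 0} + edim s2 U"
proof (cases "edim s1 {x\<in>V. g x = 0} = \<infinity> \<or> edim s2 U = \<infinity>")
  case False
  interpret S1: vector_space s1 by fact
  interpret S2: vector_space s2 by fact
  from False have fin1: "edim s1 {x\<in>V. g x = 0} \<noteq> \<infinity>" by simp
  obtain K where K: "finite K" "{x\<in>V. g x = 0} \<subseteq> S1.span K"
      "edim s1 {x\<in>V. g x = 0} = enat (card K)"
    by (rule edim_finite_basis[OF vs1 fin1])
  have le: "edim s2 (g ` V) \<le> edim s2 U" by (rule edim_mono[OF vs2 U])
  with False have fin: "edim s2 (g ` V) \<noteq> \<infinity>" by (metis enat_ord_simps(5))
  obtain C where C: "finite C" "C \<subseteq> g ` V" "g ` V \<subseteq> S2.span C"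
      "edim s2 (g ` V) = enat (card C)"
    by (rule edim_finite_basis[OF vs2 fin])
  have "\<forall>w\<in>C. \<exists>v. v \<in> V \<and> g v = w" using C(2) by blast
  from bchoice[OF this] obtain h where h: "\<And>w. w \<in> C \<Longrightarrow> h w \<in> V \<and> g (h w) = w"
    by blast
  have V0: "0 \<in> V" using V by (rule S1.subspace_0)
  have g0: "g 0 = 0" using g[OF V0 V0, of 1] by simp
  \<comment> \<open>Linearity of \<open>g\<close> is known only on \<open>V\<close>, so the span
    induction carries membership in \<open>V\<close> along.\<close>
  have lift: "\<exists>u\<in>S1.span (h ` C) \<inter> V. g u = w" if "w \<in> S2.span C" for w
    using that
  proof (induction rule: S2.span_induct_alt)
    case base
    then show ?case using g0 V0 S1.span_zero by blast
  next
    case (step c x y)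
    then obtain u where u: "u \<in> S1.span (h ` C) \<inter> V" "g u = y" by blast
    have "s1 c (h x) + u \<in> S1.span (h ` C) \<inter> V"
      using u h[OF step(1)] step(1)
      by (intro IntI S1.span_add S1.span_scale[OF S1.span_base] S1.subspace_add[OF V]
            S1.subspace_scale[OF V]) auto
    moreover have "g (s1 c (h x) + u) = s2 c x + y"
      using g[of "h x" u c] h[OF step(1)] u by auto
    ultimately show ?case by (rule rev_bexI)
  qed
  have "V \<subseteq> S1.span (K \<union> h ` C)"
  proof
    fix v assume v: "v \<in> V"
    then obtain u where u: "u \<in> S1.span (h ` C)" "u \<in> V" "g u = g v"
      using lift C(3) by blast
    have "g (s1 (-1) u + v) = 0"
      using g[OF u(2) v, of "-1"] u(3) by (simp add: S2.scale_minus_left)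
    moreover have "s1 (-1) u + v \<in> V"
      using u(2) v by (intro S1.subspace_add[OF V] S1.subspace_scale[OF V])
    ultimately have "s1 (-1) u + v \<in> S1.span K" using K(2) by blast
    moreover have eq: "s1 (-1) u + v = v - u" by (simp add: S1.scale_minus_left)
    ultimately have "v - u \<in> S1.span (K \<union> h ` C)"
      using S1.span_mono[of K "K \<union> h ` C"] eq by auto
    moreover have "u \<in> S1.span (K \<union> h ` C)"
      using S1.span_mono[of "h ` C" "K \<union> h ` C"] u(1) by auto
    ultimately show "v \<in> S1.span (K \<union> h ` C)"
      by (metis S1.span_add diff_add_cancel)
  qed
  then have "edim s1 V \<le> enat (card (K \<union> h ` C))"
    by (rule edim_le_card[OF vs1 finite_UnI[OF K(1) finite_imageI[OF C(1)]]])
  also have "\<dots> \<le> enat (card K + card C)"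
    using card_Un_le[of K "h ` C"] card_image_le[OF C(1), of h] by simp
  also have "\<dots> \<le> edim s1 {x\<in>V. g x = 0} + edim s2 U"
    using K(3) C(4) le by (simp flip: plus_enat_simps(1) add: add_left_mono)
  finally show ?thesis .
qed auto

text \<open>Passing to the kernel of one linear functional costs at most one dimension. The
  induction removes one index at a time, with \<open>V\<close> replaced by that kernel, until joint
  injectivity leaves only zero.\<close>

lemma edim_le_coordinates:
  fixes c :: "'i \<Rightarrow> 'v::ab_group_add \<Rightarrow> complex"
  assumes vs: "vector_space scl" and "finite I" and V: "module.subspace scl V"
    and lin: "\<And>i a x y. i \<in> I \<Longrightarrow> x \<in> V \<Longrightarrow> y \<in> V \<Longrightarrow> c i (scl a x + y) = a * c i x + c i y"
    and inj: "\<And>x. x \<in> V \<Longrightarrow> (\<And>i. i \<in> I \<Longrightarrow> c i x = 0) \<Longrightarrow> x = 0"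
  shows "edim scl V \<le> enat (card I)"
  using \<open>finite I\<close> V lin inj
proof (induction I arbitrary: V rule: finite_induct)
  case empty
  then have "V \<subseteq> {0}" by blast
  then show ?case using edim_zero[OF vs, of V] by simp
next
  case (insert i I)
  interpret vector_space scl by fact
  have vsC: "vector_space ((*) :: complex \<Rightarrow> complex \<Rightarrow> complex)"
    by unfold_locales (auto simp: algebra_simps)
  let ?V = "{x\<in>V. c i x = 0}"
  have zero: "c i 0 = 0"
    using insert.prems(2)[of i 0 0 1] subspace_0[OF insert.prems(1)] by simp
  have "subspace ?V"
    using subspace_0[OF insert.prems(1)] zero insert.prems(1) insert.prems(2)[of i]
    by (intro subspace_of_lincomb[OF vs]) (auto intro: subspace_add subspace_scale)
  then have "edim scl ?V \<le> enat (card I)"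
  proof (rule insert.IH)
    fix x assume "x \<in> ?V" "\<And>i. i \<in> I \<Longrightarrow> c i x = 0"
    then show "x = 0" by (intro insert.prems(3)) auto
  qed (use insert.prems(2) in auto)
  moreover have "edim ((*) :: complex \<Rightarrow> complex \<Rightarrow> complex) UNIV \<le> enat (card {1::complex})"
  proof (rule edim_le_card[OF vsC])
    note C = vsC[folded module_iff_vector_space]
    show "UNIV \<subseteq> module.span (*) {1::complex}"
      using module.span_scale[OF C module.span_base[OF C], of 1 "{1}"] by auto
  qed simp
  moreover have "edim scl V \<le> edim scl ?V + edim ((*) :: complex \<Rightarrow> complex \<Rightarrow> complex) UNIV"
    using insert.prems(2)[of i]
    by (intro edim_le_kernel[OF vs vsC insert.prems(1)]) auto
  ultimately have "edim scl V \<le> enat (card I) + enat (card {1::complex})"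
    by (meson add_mono order_trans)
  then show ?case using insert.hyps by simp
qed

section \<open>Grids in a lattice\<close>

locale lattice_basis =
  fixes L B :: "(real ^ 'n) set"
  assumes indep: "independent B" and spanB: "span B = UNIV"
    and L_eq: "L = {\<Sum>b\<in>B. of_int (a b) *\<^sub>R b | a :: real ^ 'n \<Rightarrow> int. True}"
begin

lemma finite_B: "finite B"
  using indep by (rule finiteI_independent)

lemma card_B: "card B = CARD('n)"
  using dim_eq_card[of B UNIV] indep spanB by simp

lemma L_iff: "v \<in> L \<longleftrightarrow> (\<exists>a :: real ^ 'n \<Rightarrow> int. v = (\<Sum>b\<in>B. of_int (a b) *\<^sub>R b))"
  using L_eq by auto

lemma L_I: "(\<Sum>b\<in>B. of_int (a b) *\<^sub>R b) \<in> L"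
  unfolding L_iff by blast

lemma L_zero: "0 \<in> L"
  unfolding L_iff by (intro exI[of _ "\<lambda>_. 0"]) simp

lemma L_add: "x \<in> L \<Longrightarrow> y \<in> L \<Longrightarrow> x + y \<in> L"
proof -
  assume "x \<in> L" "y \<in> L"
  then obtain f g :: "real ^ 'n \<Rightarrow> int" where
    "x = (\<Sum>b\<in>B. of_int (f b) *\<^sub>R b)" "y = (\<Sum>b\<in>B. of_int (g b) *\<^sub>R b)"
    by (auto simp: L_iff)
  then show "x + y \<in> L"
    unfolding L_iff by (intro exI[of _ "\<lambda>b. f b + g b"]) (simp add: sum.distrib scaleR_add_left)
qed

lemma L_uminus: "x \<in> L \<Longrightarrow> - x \<in> L"
proof -
  assume "x \<in> L"
  then obtain f :: "real ^ 'n \<Rightarrow> int" where "x = (\<Sum>b\<in>B. of_int (f b) *\<^sub>R b)"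
    by (auto simp: L_iff)
  then show "- x \<in> L"
    unfolding L_iff by (intro exI[of _ "\<lambda>b. - f b"]) (simp add: sum_negf)
qed

lemma L_diff: "x \<in> L \<Longrightarrow> y \<in> L \<Longrightarrow> x - y \<in> L"
  using L_add[of x "- y"] L_uminus[of y] by simp

lemma B_in_L: "b \<in> B \<Longrightarrow> b \<in> L"
  unfolding L_iff
  by (intro exI[of _ "\<lambda>c. if c = b then 1 else 0"])
     (simp add: if_distrib[of "\<lambda>u. u *\<^sub>R _"] if_distrib[of of_int] finite_B cong: if_cong)

lemma coordinates: obtains u where "v = (\<Sum>b\<in>B. u b *\<^sub>R b)"
proof -
  have "v \<in> span B" using spanB by simp
  then show ?thesis using that by (auto simp: span_finite[OF finite_B])
qed

lemma coordinates_unique: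
  assumes "(\<Sum>b\<in>B. u b *\<^sub>R b) = (\<Sum>b\<in>B. w b *\<^sub>R b)" "b \<in> B"
  shows "u b = w b"
proof -
  have "(\<Sum>b\<in>B. (u b - w b) *\<^sub>R b) = 0"
    using assms(1) by (simp add: scaleR_diff_left sum_subtractf)
  then have "u b - w b = 0"
    using independentD[OF indep finite_B subset_refl, of "\<lambda>b. u b - w b" b] assms(2) by simp
  then show ?thesis by simp
qed

section \<open>Covering by the lattice and the finite group (1/N)L / L\<close>

definition radius :: real where "radius = (\<Sum>b\<in>B. norm b)"

text \<open>Rounding the basis coordinates down leaves coordinates in [0, 1).\<close>

lemma covering: "\<exists>x\<in>L. norm (v - x) \<le> radius"
proof -
  obtain u where u: "v = (\<Sum>b\<in>B. u b *\<^sub>R b)" by (rule coordinates)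
  let ?x = "\<Sum>b\<in>B. of_int \<lfloor>u b\<rfloor> *\<^sub>R b"
  have "v - ?x = (\<Sum>b\<in>B. frac (u b) *\<^sub>R b)"
    by (simp add: u frac_def scaleR_diff_left sum_subtractf)
  also have "norm \<dots> \<le> radius"
    unfolding radius_def
  proof (rule sum_norm_le)
    fix b assume "b \<in> B"
    have "\<bar>frac (u b)\<bar> * norm b \<le> 1 * norm b"
      using frac_lt_1[of "u b"] frac_ge_0[of "u b"] by (intro mult_right_mono) auto
    then show "norm (frac (u b) *\<^sub>R b) \<le> norm b" by simp
  qed
  finally show ?thesis using L_I by (rule bexI)
qed

text \<open>For \<open>N > 0\<close>, one representative of each class of (1/N)L modulo
  \<open>L\<close>, taken in the half-open fundamental parallelotope.\<close>

definition grid :: "nat \<Rightarrow> (real ^ 'n) set" where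
  "grid N = (\<lambda>j. \<Sum>b\<in>B. (of_int (j b) / of_nat N) *\<^sub>R b) ` (B \<rightarrow>\<^sub>E {0..<int N})"

lemma finite_grid: "finite (grid N)"
  unfolding grid_def by (intro finite_imageI finite_PiE finite_B) auto

lemma grid_scale:
  assumes "N > 0" "s \<in> grid N" shows "real N *\<^sub>R s \<in> L"
proof -
  obtain j where "s = (\<Sum>b\<in>B. (of_int (j b) / of_nat N) *\<^sub>R b)"
    using assms(2) by (auto simp: grid_def)
  then have "real N *\<^sub>R s = (\<Sum>b\<in>B. of_int (j b) *\<^sub>R b)"
    using assms(1) by (simp add: scaleR_sum_right)
  then show ?thesis by (simp add: L_I)
qed

lemma grid_representative:
  assumes "N > 0" "real N *\<^sub>R u \<in> L"
  shows "\<exists>s\<in>grid N. u - s \<in> L"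
proof -
  obtain a :: "real ^ 'n \<Rightarrow> int" where a: "real N *\<^sub>R u = (\<Sum>b\<in>B. of_int (a b) *\<^sub>R b)"
    using assms(2) L_iff by blast
  have "u = (1 / real N) *\<^sub>R (real N *\<^sub>R u)" using assms(1) by simp
  also have "\<dots> = (\<Sum>b\<in>B. (of_int (a b) / real N) *\<^sub>R b)"
    unfolding a by (simp add: scaleR_sum_right)
  finally have u: "u = (\<Sum>b\<in>B. (of_int (a b) / real N) *\<^sub>R b)" .
  let ?j = "restrict (\<lambda>b. a b mod int N) B"
  let ?s = "\<Sum>b\<in>B. (of_int (?j b) / of_nat N) *\<^sub>R b"
  have "?s \<in> grid N" unfolding grid_def using assms(1) by (intro imageI) auto
  have "u - ?s = (\<Sum>b\<in>B. of_int (a b div int N) *\<^sub>R b)"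
    unfolding u sum_subtractf[symmetric] scaleR_diff_left[symmetric]
  proof (rule sum.cong)
    fix b assume b: "b \<in> B"
    have "real_of_int (a b) = of_int (a b div int N) * real N + of_int (a b mod int N)"
      by (metis div_mult_mod_eq of_int_add of_int_mult of_int_of_nat_eq)
    then have "of_int (a b) / real N - of_int (?j b) / real N = of_int (a b div int N)"
      using assms(1) b by (simp add: field_simps)
    then show "(of_int (a b) / real N - of_int (?j b) / real N) *\<^sub>R b = of_int (a b div int N) *\<^sub>R b"
      by simp
  qed simp
  then have "u - ?s \<in> L" using L_I by (rule ssubst)
  with \<open>?s \<in> grid N\<close> show ?thesis by (rule rev_bexI)
qed

lemma grid_unique:
  assumes "N > 0" "s \<in> grid N" "t \<in> grid N" "s - t \<in> L"
  shows "s = t"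
proof -
  obtain i where i: "i \<in> B \<rightarrow>\<^sub>E {0..<int N}" "s = (\<Sum>b\<in>B. (of_int (i b) / of_nat N) *\<^sub>R b)"
    using assms(2) by (auto simp: grid_def)
  obtain j where j: "j \<in> B \<rightarrow>\<^sub>E {0..<int N}" "t = (\<Sum>b\<in>B. (of_int (j b) / of_nat N) *\<^sub>R b)"
    using assms(3) by (auto simp: grid_def)
  obtain a :: "real ^ 'n \<Rightarrow> int" where a: "s - t = (\<Sum>b\<in>B. of_int (a b) *\<^sub>R b)"
    using assms(4) L_iff by blast
  have "i b = j b" if b: "b \<in> B" for b
  proof -
    have "(\<Sum>b\<in>B. (of_int (i b) / real N - of_int (j b) / real N) *\<^sub>R b) = (\<Sum>b\<in>B. of_int (a b) *\<^sub>R b)"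
      using a unfolding i j by (simp add: scaleR_diff_left sum_subtractf)
    then have "of_int (i b) / real N - of_int (j b) / real N = of_int (a b)"
      by (rule coordinates_unique[OF _ b])
    then have "real_of_int (i b - j b) = of_int (a b * int N)"
      using assms(1) by (simp add: field_simps)
    then have eq: "i b - j b = a b * int N" unfolding of_int_eq_iff .
    have "0 \<le> i b" "i b < int N" "0 \<le> j b" "j b < int N" using i(1) j(1) b by auto
    moreover have "i b mod int N = j b mod int N"
      using eq by (metis mod_eq_dvd_iff dvd_triv_right)
    ultimately show ?thesis by (metis mod_pos_pos_trivial)
  qed
  then show ?thesis using i j by (metis (no_types, lifting) sum.cong)
qed

text \<open>\<open>h\<close> induces an injective, hence bijective, self-map of the finite group
  (1/N)L / L, and the periodic \<open>g\<close> depends only on classes. Shifts and negation are the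
  two instances used.\<close>

lemma grid_prod_permute:
  fixes g :: "real ^ 'n \<Rightarrow> 'c::comm_monoid_mult"
  assumes N: "N > 0"
    and per: "\<And>v x. x \<in> L \<Longrightarrow> g (v + x) = g v"
    and h: "\<And>s. s \<in> grid N \<Longrightarrow> real N *\<^sub>R h s \<in> L"
    and inj: "\<And>s t. s \<in> grid N \<Longrightarrow> t \<in> grid N \<Longrightarrow> h s - h t \<in> L \<Longrightarrow> s - t \<in> L"
  shows "(\<Prod>s\<in>grid N. g (h s)) = (\<Prod>s\<in>grid N. g s)"
proof -
  have "\<forall>s\<in>grid N. \<exists>r. r \<in> grid N \<and> h s - r \<in> L"
    using grid_representative[OF N h] by blast
  from bchoice[OF this] obtain r where r: "\<And>s. s \<in> grid N \<Longrightarrow> r s \<in> grid N"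
      "\<And>s. s \<in> grid N \<Longrightarrow> h s - r s \<in> L"
    by blast
  have "inj_on r (grid N)"
  proof (rule inj_onI)
    fix s t assume st: "s \<in> grid N" "t \<in> grid N" "r s = r t"
    have "(h s - r s) - (h t - r t) \<in> L" using r(2)[OF st(1)] r(2)[OF st(2)] by (rule L_diff)
    then have "h s - h t \<in> L" using st(3) by simp
    then show "s = t" using inj st grid_unique[OF N] by blast
  qed
  then have "bij_betw r (grid N) (grid N)"
    using r(1) finite_grid by (simp add: bij_betw_def endo_inj_surj image_subset_iff)
  then have "(\<Prod>s\<in>grid N. g s) = (\<Prod>s\<in>grid N. g (r s))"
    by (rule prod.reindex_bij_betw[symmetric])
  also have "\<dots> = (\<Prod>s\<in>grid N. g (h s))"
  proof (rule prod.cong)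
    fix s assume "s \<in> grid N"
    from per[OF r(2)[OF this], of "r s"] show "g (r s) = g (h s)" by simp
  qed simp
  finally show ?thesis by simp
qed

lemma grid_prod_shift:
  fixes g :: "real ^ 'n \<Rightarrow> 'c::comm_monoid_mult"
  assumes "N > 0" "\<And>v x. x \<in> L \<Longrightarrow> g (v + x) = g v" "real N *\<^sub>R u \<in> L"
  shows "(\<Prod>s\<in>grid N. g (u + s)) = (\<Prod>s\<in>grid N. g s)"
  using grid_scale[OF assms(1)]
  by (intro grid_prod_permute[OF assms(1,2)]) (auto simp: scaleR_add_right intro: L_add assms(3))

lemma grid_prod_uminus:
  fixes g :: "real ^ 'n \<Rightarrow> 'c::comm_monoid_mult"
  assumes "N > 0" "\<And>v x. x \<in> L \<Longrightarrow> g (v + x) = g v"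
  shows "(\<Prod>s\<in>grid N. g (- s)) = (\<Prod>s\<in>grid N. g s)"
proof (rule grid_prod_permute[OF assms])
  fix s t assume "- s - - t \<in> L"
  from L_uminus[OF this] show "s - t \<in> L" by simp
qed (auto intro: L_uminus grid_scale[OF assms(1)])

text \<open>Scaling by \<open>N\<close> turns \<open>covering\<close> into a covering by (1/N)L,
  whose points split into a grid point and an element of \<open>L\<close>.\<close>

lemma grid_covering:
  assumes N: "N > 0"
  shows "\<exists>s\<in>grid N. \<exists>x\<in>L. norm (v + s + x) \<le> radius / N"
proof -
  obtain y where y: "y \<in> L" "norm (real N *\<^sub>R (- v) - y) \<le> radius"
    using covering by blast
  let ?u = "(1 / real N) *\<^sub>R y"
  obtain s where s: "s \<in> grid N" "?u - s \<in> L"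
    using grid_representative[OF N, of ?u] y(1) N by auto
  have "real N *\<^sub>R (v + s + (?u - s)) = - (real N *\<^sub>R (- v) - y)"
    using N by (simp add: algebra_simps)
  then have "real N * norm (v + s + (?u - s)) \<le> radius"
    using y(2) by (metis abs_of_nat norm_minus_cancel norm_scaleR)
  then show ?thesis using s N by (intro bexI[OF _ s(1)] bexI[OF _ s(2)]) (simp add: field_simps)
qed

lemma grid_nonempty: "N > 0 \<Longrightarrow> grid N \<noteq> {}"
  using grid_covering by blast

section \<open>Counting points of the dual lattice\<close>

definition norm_bound :: nat where "norm_bound = nat \<lceil>radius\<rceil>"

text \<open>A vector is determined by its pairings with a basis. On the dual lattice these are
  integers, so the floor loses nothing.\<close>

lemma dual_coordinates_inj: "inj_on (\<lambda>v. \<lambda>b\<in>B. \<lfloor>v \<bullet> b\<rfloor>) (dual_lattice L)"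
proof (rule inj_onI)
  fix v w assume v: "v \<in> dual_lattice L" and w: "w \<in> dual_lattice L"
    and eq: "(\<lambda>b\<in>B. \<lfloor>v \<bullet> b\<rfloor>) = (\<lambda>b\<in>B. \<lfloor>w \<bullet> b\<rfloor>)"
  have "(v - w) \<bullet> b = 0" if b: "b \<in> B" for b
  proof -
    have "v \<bullet> b \<in> \<int>" "w \<bullet> b \<in> \<int>" using v w B_in_L[OF b] by (auto simp: dual_lattice_def)
    moreover have "\<lfloor>v \<bullet> b\<rfloor> = \<lfloor>w \<bullet> b\<rfloor>" using fun_cong[OF eq, of b] b by simp
    ultimately show ?thesis by (auto elim!: Ints_cases simp: inner_diff_left)
  qed
  moreover obtain u where "v - w = (\<Sum>b\<in>B. u b *\<^sub>R b)" by (rule coordinates)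
  ultimately have "(v - w) \<bullet> (v - w) = 0" by (metis (no_types, lifting) inner_scaleR_right inner_sum_right mult_zero_right sum.neutral)
  then show "v = w" by simp
qed

lemma countable_dual: "countable (dual_lattice L)"
proof -
  have "(\<lambda>v. \<lambda>b\<in>B. \<lfloor>v \<bullet> b\<rfloor>) ` dual_lattice L \<subseteq> (\<Pi>\<^sub>E b\<in>B. (UNIV :: int set))" by auto
  then have "countable ((\<lambda>v. \<lambda>b\<in>B. \<lfloor>v \<bullet> b\<rfloor>) ` dual_lattice L)"
    using countable_PiE[OF finite_B, of "\<lambda>_. UNIV :: int set"] countable_subset by auto
  then show ?thesis using dual_coordinates_inj countable_image_inj_on by blast
qed

text \<open>By Cauchy-Schwarz the integer pairings have absolute value at most
  \<open>r * norm_bound\<close>, so the ball embeds into a box with one side for each basis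
  vector.\<close>

lemma dual_ball:
  "finite {v \<in> dual_lattice L. norm v \<le> real r}"
  "card {v \<in> dual_lattice L. norm v \<le> real r} \<le> (2 * r * norm_bound + 1) ^ CARD('n)"
proof -
  let ?S = "{v \<in> dual_lattice L. norm v \<le> real r}" and ?c = "\<lambda>v. \<lambda>b\<in>B. \<lfloor>v \<bullet> b\<rfloor>"
  let ?I = "{- int (r * norm_bound)..int (r * norm_bound)}"
  have sub: "?c ` ?S \<subseteq> (B \<rightarrow>\<^sub>E ?I)"
  proof (clarsimp intro!: restrict_PiE_iff[THEN iffD2])
    fix v b assume v: "v \<in> dual_lattice L" "norm v \<le> real r" and b: "b \<in> B"
    have "norm b \<le> radius" unfolding radius_def using b finite_B by (intro member_le_sum) auto
    also have "\<dots> \<le> real norm_bound" unfolding norm_bound_def by linarith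
    finally have "\<bar>v \<bullet> b\<bar> \<le> real r * real norm_bound"
      using Cauchy_Schwarz_ineq2[of v b] mult_mono[OF v(2), of "norm b" "real norm_bound"] by simp
    then have "\<bar>v \<bullet> b\<bar> \<le> of_int (int (r * norm_bound))" by simp
    moreover obtain j where "v \<bullet> b = of_int j"
      using v(1) B_in_L[OF b] by (auto simp: dual_lattice_def elim: Ints_cases)
    ultimately show "- (int r * int norm_bound) \<le> \<lfloor>v \<bullet> b\<rfloor> \<and> \<lfloor>v \<bullet> b\<rfloor> \<le> int r * int norm_bound"
      by (metis abs_le_iff floor_of_int minus_le_iff of_int_abs of_int_le_iff of_nat_mult)
  qed
  have inj: "inj_on ?c ?S" by (rule inj_on_subset[OF dual_coordinates_inj]) auto
  have fin: "finite (B \<rightarrow>\<^sub>E ?I)" by (intro finite_PiE finite_B) auto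
  show "finite ?S" using finite_subset[OF sub fin] inj finite_image_iff by blast
  have "card ?S \<le> card (B \<rightarrow>\<^sub>E ?I)" by (rule card_inj_on_le[OF inj sub fin])
  also have "\<dots> = (2 * r * norm_bound + 1) ^ CARD('n)"
    by (simp add: card_PiE finite_B card_B nat_add_distrib nat_mult_distrib mult.assoc flip: of_nat_mult)
  finally show "card ?S \<le> (2 * r * norm_bound + 1) ^ CARD('n)" .
qed

end

section \<open>Uniqueness of Fourier coefficients\<close>

text \<open>The geometric sums stay bounded by \<open>2 / norm (w - 1)\<close>.\<close>

lemma geometric_mean_tendsto_0:
  fixes w :: complex
  assumes "norm w = 1" "w \<noteq> 1"
  shows "(\<lambda>S. (\<Sum>s<S. w ^ s) / of_nat S) \<longlonglongrightarrow> 0"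
proof (rule Lim_null_comparison)
  have "norm ((\<Sum>s<S. w ^ s) / of_nat S) \<le> (2 / norm (w - 1)) * (1 / real S)" for S
  proof -
    have "(\<Sum>s<S. w ^ s) = (w ^ S - 1) / (w - 1)"
      using geometric_sum[OF assms(2)] by simp
    moreover have "norm (w ^ S - 1) \<le> 2"
      using norm_triangle_ineq4[of "w ^ S" 1] assms(1) by (simp add: norm_power)
    ultimately have "norm (\<Sum>s<S. w ^ s) \<le> 2 / norm (w - 1)"
      by (simp add: norm_divide divide_right_mono)
    from divide_right_mono[OF this, of "real S"] show ?thesis
      by (simp add: norm_divide)
  qed
  then show "\<forall>\<^sub>F S in sequentially. norm ((\<Sum>s<S. w ^ s) / of_nat S) \<le> (2 / norm (w - 1)) * (1 / real S)"
    by simp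
  have "(\<lambda>S. 1 / real S) \<longlonglongrightarrow> 0" by (rule lim_1_over_n)
  from tendsto_mult_left[OF this, of "2 / norm (w - 1)"]
  show "(\<lambda>S. (2 / norm (w - 1)) * (1 / real S)) \<longlonglongrightarrow> 0" by (simp only: mult_zero_right)
qed

lemma cis_eq_1_imp: "cis x = 1 \<Longrightarrow> \<exists>j::int. x = 2 * pi * of_int j"
  using complex_eq_iff[of "cis x" 1] cos_one_2pi_int[of x] by auto

lemma has_sum_finite_sum:
  fixes f :: "'s \<Rightarrow> 'i \<Rightarrow> complex"
  assumes "finite S" "\<And>s. s \<in> S \<Longrightarrow> (f s has_sum 0) I"
  shows "((\<lambda>v. \<Sum>s\<in>S. f s v) has_sum 0) I"
  using assms
proof (induction S rule: finite_induct)
  case (insert s S)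
  then have "(f s has_sum 0) I" "((\<lambda>v. \<Sum>s\<in>S. f s v) has_sum 0) I" by auto
  from has_sum_add[OF this] show ?case using insert.hyps by simp
qed simp

text \<open>
  In a direction \<open>u\<close> that separates the frequencies modulo \<open>2 * pi\<close>, averaging against the
  conjugate of one character isolates its coefficient.
\<close>

lemma character_sum_unique:
  fixes c :: "'i \<Rightarrow> complex" and \<nu> :: "'i \<Rightarrow> 'a::euclidean_space"
  assumes "countable I" "inj_on \<nu> I"
    and sum0: "\<And>u. ((\<lambda>v. c v * cis (\<nu> v \<bullet> u)) has_sum 0) I"
    and "v0 \<in> I"
  shows "c v0 = 0"
proof -
  \<comment> \<open>The bad directions, in which another frequency agrees with
    \<open>\<nu> v0\<close> modulo \<open>2 * pi\<close>, fill countably many hyperplanes, a null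
    set; some \<open>u\<close> avoids them all.\<close>
  define H where "H = (\<lambda>(v, j::int). {u. (\<nu> v - \<nu> v0) \<bullet> u = 2 * pi * of_int j}) ` ((I - {v0}) \<times> UNIV)"
  have "negligible (\<Union>H)"
  proof (rule negligible_countable_Union)
    show "countable H"
      unfolding H_def using assms(1) by (intro countable_image countable_SIGMA) auto
  next
    fix S assume "S \<in> H"
    then obtain v and j :: int where "v \<in> I - {v0}" "S = {u. (\<nu> v - \<nu> v0) \<bullet> u = 2 * pi * of_int j}"
      by (auto simp: H_def)
    moreover from this have "\<nu> v - \<nu> v0 \<noteq> 0" using assms(2,4) by (auto dest: inj_onD)
    ultimately show "negligible S" using negligible_hyperplane by blast
  qed
  then have "\<Union>H \<noteq> UNIV" by (metis non_negligible_UNIV)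
  then obtain u where "u \<notin> \<Union>H" by blast
  then have u: "(\<nu> v - \<nu> v0) \<bullet> u \<noteq> 2 * pi * of_int j" if "v \<in> I - {v0}" for v and j :: int
    using that unfolding H_def by fast
  define w where "w v = cis ((\<nu> v - \<nu> v0) \<bullet> u)" for v
  have w1: "w v \<noteq> 1" if "v \<in> I" "v \<noteq> v0" for v
    using u[of v] cis_eq_1_imp that unfolding w_def by blast
  have ws: "((\<lambda>v. c v * w v ^ s) has_sum 0) I" for s :: nat
  proof -
    have eq: "c v * w v ^ s = cis (- (\<nu> v0 \<bullet> (real s *\<^sub>R u))) * (c v * cis (\<nu> v \<bullet> (real s *\<^sub>R u)))" for v
    proof -
      have "w v ^ s = cis (real s * ((\<nu> v - \<nu> v0) \<bullet> u))" unfolding w_def by (rule Complex.DeMoivre)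
      also have "\<dots> = cis (- (\<nu> v0 \<bullet> (real s *\<^sub>R u))) * cis (\<nu> v \<bullet> (real s *\<^sub>R u))"
        unfolding cis_mult by (simp add: algebra_simps inner_diff_left)
      finally show ?thesis by simp
    qed
    show ?thesis
      unfolding eq
      using has_sum_cmult_right[OF sum0[of "real s *\<^sub>R u"], of "cis (- (\<nu> v0 \<bullet> (real s *\<^sub>R u)))"]
      by (simp only: mult_zero_right)
  qed
  \<comment> \<open>The mean of the powers is 1 at \<open>v0\<close> for \<open>S > 0\<close>,
    bounded by 1 everywhere, and tends to 0 at every other index.\<close>
  define K where "K S v = (\<Sum>s<S. w v ^ s) / of_nat S" for S v
  have Ksum: "((\<lambda>v. c v * K S v) has_sum 0) I" for S
  proof -
    have "((\<lambda>v. \<Sum>s<S. c v * w v ^ s) has_sum 0) I" by (intro has_sum_finite_sum ws) auto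
    from has_sum_cmult_left[OF this, of "1 / of_nat S"] show ?thesis
      by (simp add: K_def sum_distrib_left)
  qed
  have Knorm: "norm (K S v) \<le> 1" for S v
  proof -
    have "norm (\<Sum>s<S. w v ^ s) \<le> (\<Sum>s<S. 1)"
      by (intro sum_norm_le) (simp add: w_def norm_power)
    then show ?thesis by (cases "S = 0") (auto simp: K_def norm_divide)
  qed
  have Kv0: "K S v0 = 1" if "S > 0" for S using that by (simp add: K_def w_def)
  have abs: "(\<lambda>v. norm (c v)) summable_on I"
    using sum0[of 0] by (simp add: summable_on_iff_abs_summable_on_complex[symmetric])
       (auto simp: summable_on_def)
  have "norm (c v0) \<le> e" if e: "e > 0" for e
  proof -
    \<comment> \<open>A finite set catches all but \<open>e\<close> of the absolute mass. As
      \<open>K\<close> is bounded by 1, the tail is at most \<open>e\<close> uniformly in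
      \<open>S\<close>, and the limit is needed only in a finite sum.\<close>
    obtain F0 where F0: "finite F0" "F0 \<subseteq> I"
        "dist (\<Sum>v\<in>F0. norm (c v)) (\<Sum>\<^sub>\<infinity>v\<in>I. norm (c v)) \<le> e"
      using has_sum_finite_approximation[OF has_sum_infsum[OF abs] e] by blast
    define F where "F = insert v0 F0"
    have F: "finite F" "F \<subseteq> I" "v0 \<in> F" using F0 assms(4) by (auto simp: F_def)
    have absF: "(\<lambda>v. norm (c v)) summable_on (I - F)" using abs by (rule summable_on_subset) auto
    have I: "F \<union> (I - F) = I" "F \<inter> (I - F) = {}" using F by auto
    have "(\<Sum>\<^sub>\<infinity>v\<in>I. norm (c v)) = (\<Sum>v\<in>F. norm (c v)) + (\<Sum>\<^sub>\<infinity>v\<in>I - F. norm (c v))"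
      using infsumI[OF has_sum_Un_disjoint[OF has_sum_finite[OF F(1)] has_sum_infsum[OF absF] I(2)]]
      unfolding I(1) .
    moreover have "(\<Sum>v\<in>F0. norm (c v)) \<le> (\<Sum>v\<in>F. norm (c v))"
      using F(1) by (intro sum_mono2) (auto simp: F_def)
    ultimately have tail: "(\<Sum>\<^sub>\<infinity>v\<in>I - F. norm (c v)) \<le> e"
      using F0(3) by (simp add: dist_real_def)
    have bd: "norm (\<Sum>v\<in>F. c v * K S v) \<le> e" for S
    proof -
      have "(\<lambda>v. c v * K S v) summable_on (I - F)"
        by (rule summable_on_subset[OF has_sum_imp_summable[OF Ksum[of S]]]) auto
      then obtain r where r: "((\<lambda>v. c v * K S v) has_sum r) (I - F)" by (auto simp: summable_on_def)
      have "(\<Sum>v\<in>F. c v * K S v) + r = 0"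
        using has_sum_unique[OF has_sum_Un_disjoint[OF has_sum_finite[OF F(1)] r I(2), unfolded I(1)] Ksum[of S]]
        .
      then have "norm (\<Sum>v\<in>F. c v * K S v) = norm r"
        by (metis add_eq_0_iff norm_minus_cancel)
      also have "norm r \<le> (\<Sum>\<^sub>\<infinity>v\<in>I - F. norm (c v))"
      proof (rule norm_infsum_le[OF r has_sum_infsum[OF absF]])
        show "norm (c v * K S v) \<le> norm (c v)" for v
          using mult_left_mono[OF Knorm[of S v], of "norm (c v)"] by (simp add: norm_mult)
      qed
      finally show ?thesis using tail by simp
    qed
    have "(\<lambda>S. c v * K S v) \<longlonglongrightarrow> (if v = v0 then c v0 else 0)" if "v \<in> F" for v
    proof (cases "v = v0")
      case True
      have "\<forall>\<^sub>F S in sequentially. c v * K S v = c v0"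
        using eventually_gt_at_top[of 0] by eventually_elim (simp add: True Kv0)
      then show ?thesis using True by (simp add: tendsto_eventually)
    next
      case False
      then have "(\<lambda>S. K S v) \<longlonglongrightarrow> 0"
        unfolding K_def using w1[of v] F(2) that by (intro geometric_mean_tendsto_0) (auto simp: w_def)
      from tendsto_mult_left[OF this, of "c v"] show ?thesis using False by simp
    qed
    then have "(\<lambda>S. \<Sum>v\<in>F. c v * K S v) \<longlonglongrightarrow> (\<Sum>v\<in>F. if v = v0 then c v0 else 0)"
      by (rule tendsto_sum)
    moreover have "(\<Sum>v\<in>F. if v = v0 then c v0 else 0) = c v0" using F by simp
    ultimately have "(\<lambda>S. \<Sum>v\<in>F. c v * K S v) \<longlonglongrightarrow> c v0" by simp
    from tendsto_norm[OF this] show ?thesis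
      by (rule LIMSEQ_le_const2) (use bd in auto)
  qed
  from this[of "norm (c v0) / 2"] show ?thesis by (cases "c v0 = 0") auto
qed

lemma cdot_cvec_cvec: "cdot (cvec x) (cvec y) = of_real (x \<bullet> y)"
  by (simp add: cdot_def cvec_def inner_vec_def)

text \<open>On \<open>\<tau> = x + \<i>\<close> with \<open>x\<close> and \<open>z\<close> real, the
  monomials become characters of \<open>real \<times> (real ^ 'n)\<close> with distinct frequencies;
  the factor exp(-2 pi n) is absorbed into the coefficient.\<close>

lemma fourier_expansion_of_zero:
  fixes L :: "(real ^ 'n) set"
  assumes "full_lattice L" "fourier_expansion L m 0 f"
  shows "f n l = 0"
proof (cases "l \<in> dual_lattice L")
  case True
  obtain B where "lattice_basis L B"
    using assms(1) unfolding full_lattice_def lattice_basis_def by blast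
  then interpret lattice_basis L B .
  define I where "I = (UNIV :: nat set) \<times> dual_lattice L"
  define c where "c = (\<lambda>(n, l). f n l * exp (- (2 * pi * real n)))"
  define \<nu> :: "nat \<times> (real ^ 'n) \<Rightarrow> real \<times> (real ^ 'n)" where "\<nu> = (\<lambda>(n, l). (2 * pi * real n, (2 * pi) *\<^sub>R l))"
  have "c (n, l) = 0"
  proof (rule character_sum_unique[where \<nu> = \<nu> and I = I])
    show "countable I" unfolding I_def using countable_dual by (intro countable_SIGMA) auto
    show "inj_on \<nu> I" by (auto simp: inj_on_def \<nu>_def)
    show "(n, l) \<in> I" using True by (simp add: I_def)
    fix u :: "real \<times> (real ^ 'n)"
    obtain x y where u: "u = (x, y)" by (cases u)
    define \<tau> where "\<tau> = complex_of_real x + \<i>"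
    have "((\<lambda>(n, l). f n l * exp (2 * pi * \<i> * \<tau>) ^ n * exp (2 * pi * \<i> * cdot (cvec l) (cvec y)))
           has_sum 0) I"
      using assms(2) unfolding fourier_expansion_def I_def
      by (simp add: \<tau>_def upper_half_plane_def zero_fun_def)
    moreover have "f n l * exp (2 * pi * \<i> * \<tau>) ^ n * exp (2 * pi * \<i> * cdot (cvec l) (cvec y))
        = c (n, l) * cis (\<nu> (n, l) \<bullet> u)" for n l
      unfolding cdot_cvec_cvec c_def \<nu>_def u \<tau>_def cis_conv_exp
      by (simp add: exp_of_nat_mult[symmetric] exp_add[symmetric] exp_of_real[symmetric] algebra_simps)
    ultimately show "((\<lambda>v. c v * cis (\<nu> v \<bullet> u)) has_sum 0) I"
      by (simp add: case_prod_unfold)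
  qed
  then show ?thesis by (simp add: c_def)
next
  case False
  then show ?thesis using assms(2) by (simp add: fourier_expansion_def)
qed

lemma fourier_expansion_unique:
  fixes L :: "(real ^ 'n) set"
  assumes "full_lattice L" "fourier_expansion L m \<phi> f" "fourier_expansion L m \<phi> g"
  shows "f = g"
proof -
  have "scale_fun (-1) \<phi> + \<phi> = 0" by (simp add: scale_fun_def fun_eq_iff)
  then have "fourier_expansion L m 0 (\<lambda>n l. - 1 * f n l + g n l)"
    using fourier_expansion_lincomb[OF assms(2,3), of "-1"] by simp
  from fourier_expansion_of_zero[OF assms(1) this] show ?thesis by (simp add: fun_eq_iff)
qed

section \<open>Jacobi forms along real coordinates\<close>

lemma cdot_add_left: "cdot (x + y) w = cdot x w + cdot y w"
  by (simp add: cdot_def algebra_simps sum.distrib)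

lemma cdot_add_right: "cdot w (x + y) = cdot w x + cdot w y"
  by (simp add: cdot_def algebra_simps sum.distrib)

lemma cdot_scale_left: "cdot (c *s x) w = c * cdot x w"
  by (simp add: cdot_def sum_distrib_left mult.assoc)

lemma cdot_scale_right: "cdot w (c *s x) = c * cdot w x"
  by (simp add: cdot_def sum_distrib_left algebra_simps)

lemma cvec_add: "cvec (x + y) = cvec x + cvec y"
  by (simp add: cvec_def vec_eq_iff)

lemmas cdot_simps = cdot_add_left cdot_add_right cdot_scale_left cdot_scale_right cdot_cvec_cvec

lemma bounded_linear_smult_left: "bounded_linear (\<lambda>t. t *s (v :: complex ^ 'n))"
proof -
  have "linear (\<lambda>t. t *s v)"
    by (rule linearI) (auto simp: vec_eq_iff algebra_simps)
  then show ?thesis by (rule linear_conv_bounded_linear[THEN iffD1])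
qed

lemma continuous_on_cvec [continuous_intros]:
  "continuous_on S g \<Longrightarrow> continuous_on S (\<lambda>x. cvec (g x))"
  unfolding cvec_def by (intro continuous_intros) auto

lemma continuous_on_smult [continuous_intros]:
  fixes g :: "'x::topological_space \<Rightarrow> complex ^ 'n"
  shows "continuous_on S h \<Longrightarrow> continuous_on S g \<Longrightarrow> continuous_on S (\<lambda>x. h x *s g x)"
  unfolding vector_scalar_mult_def by (intro continuous_intros) auto

lemma continuous_on_holomorphic_jac:
  fixes \<phi> :: "complex \<times> (complex ^ 'n) \<Rightarrow> complex"
  assumes "holomorphic_jac \<phi>"
  shows "continuous_on (upper_half_plane \<times> UNIV) \<phi>"
proof (intro continuous_at_imp_continuous_on ballI)
  fix p :: "complex \<times> (complex ^ 'n)" assume "p \<in> upper_half_plane \<times> UNIV"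
  then obtain \<tau> z where "p = (\<tau>, z)" "\<tau> \<in> upper_half_plane" by auto
  then show "isCont \<phi> p"
    using assms has_derivative_continuous unfolding holomorphic_jac_def by blast
qed

text \<open>The slope \<open>\<alpha>\<close> covers both later uses: with 1, \<open>\<tau>\<close>
  and \<open>z\<close> move together at fixed real coordinates; with 0, only \<open>z\<close>
  moves.\<close>

lemma holomorphic_on_line:
  assumes "holomorphic_jac \<phi>" and S: "\<And>x. x \<in> S \<Longrightarrow> \<alpha> * x + \<tau> \<in> upper_half_plane"
  shows "(\<lambda>x. \<phi> (\<alpha> * x + \<tau>, x *s v + w)) holomorphic_on S"
  unfolding holomorphic_on_def
proof
  fix x assume x: "x \<in> S"
  obtain a b where D: "(\<phi> has_derivative (\<lambda>(t, w). a * t + cdot b w)) (at (\<alpha> * x + \<tau>, x *s v + w))"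
    using assms(1) S[OF x] unfolding holomorphic_jac_def by blast
  have "((\<lambda>x. (\<alpha> * x + \<tau>, x *s v + w)) has_derivative (\<lambda>t. (\<alpha> * t, t *s v))) (at x)"
    by (rule has_derivative_Pair)
       (auto intro!: derivative_eq_intros bounded_linear_imp_has_derivative bounded_linear_smult_left)
  from has_derivative_compose[OF this D]
  have "((\<lambda>x. \<phi> (\<alpha> * x + \<tau>, x *s v + w)) has_derivative (\<lambda>t. a * (\<alpha> * t) + cdot b (t *s v))) (at x)"
    by simp
  moreover have "(\<lambda>t. a * (\<alpha> * t) + cdot b (t *s v)) = (*) (a * \<alpha> + cdot b v)"
    by (auto simp: fun_eq_iff cdot_simps algebra_simps)
  ultimately have "((\<lambda>x. \<phi> (\<alpha> * x + \<tau>, x *s v + w)) has_field_derivative (a * \<alpha> + cdot b v)) (at x)"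
    by (simp add: has_field_derivative_def)
  then show "(\<lambda>x. \<phi> (\<alpha> * x + \<tau>, x *s v + w)) field_differentiable at x within S"
    using field_differentiable_at_within field_differentiable_def by blast
qed

section \<open>Transformation laws in real coordinates\<close>

locale jacobi_form = lattice_basis L B for L B :: "(real ^ 'n) set" +
  fixes k m :: nat and \<phi> :: "complex \<times> (complex ^ 'n) \<Rightarrow> complex"
    and f :: "nat \<Rightarrow> real ^ 'n \<Rightarrow> complex"
  assumes jac: "\<phi> \<in> jacobi_forms k L m" and expansion: "fourier_expansion L m \<phi> f"
begin

lemma holomorphic: "holomorphic_jac \<phi>"
  using jac by (simp add: jacobi_forms_def)

lemma modular:
  assumes "a * d - b * c = 1" "\<tau> \<in> upper_half_plane"
  shows "(of_int c * \<tau> + of_int d) powi (- int k) *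
        exp (- (pi * \<i> * of_nat m * (of_int c * cdot z z / (of_int c * \<tau> + of_int d)))) *
        \<phi> ((of_int a * \<tau> + of_int b) / (of_int c * \<tau> + of_int d),
           (1 / (of_int c * \<tau> + of_int d)) *s z) = \<phi> (\<tau>, z)"
  using jac assms unfolding jacobi_forms_def by blast

lemma elliptic:
  assumes "x \<in> L" "y \<in> L" "\<tau> \<in> upper_half_plane"
  shows "exp (pi * \<i> * of_nat m * (of_real (x \<bullet> x) * \<tau> + 2 * cdot (cvec x) z)) *
        \<phi> (\<tau>, z + \<tau> *s cvec x + cvec y) = \<phi> (\<tau>, z)"
  using jac assms unfolding jacobi_forms_def by blast

definition Phi :: "complex \<Rightarrow> real ^ 'n \<Rightarrow> real ^ 'n \<Rightarrow> complex" where
  "Phi \<tau> a b = exp (pi * \<i> * of_nat m * of_real (a \<bullet> a) * \<tau>) * \<phi> (\<tau>, \<tau> *s cvec a + cvec b)"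

text \<open>Expanding the square of \<open>a + x\<close> in the exponent produces exactly the
  elliptic factor of \<open>x\<close>, up to the phase exp(-2 pi i m x.b), which the norm
  removes.\<close>

lemma Phi_translate:
  assumes "x \<in> L" "y \<in> L" "Im \<tau> > 0"
  shows "norm (Phi \<tau> (a + x) (b + y)) = norm (Phi \<tau> a b)"
proof -
  let ?z = "\<tau> *s cvec a + cvec b"
  have arg: "\<tau> *s cvec (a + x) + cvec (b + y) = ?z + \<tau> *s cvec x + cvec y"
    by (simp add: cvec_add vector_add_ldistrib algebra_simps)
  have ex: "exp (pi * \<i> * of_nat m * of_real ((a + x) \<bullet> (a + x)) * \<tau>)
     = exp (pi * \<i> * of_nat m * of_real (a \<bullet> a) * \<tau>)
       * exp (pi * \<i> * of_nat m * (of_real (x \<bullet> x) * \<tau> + 2 * cdot (cvec x) ?z))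
       * exp (\<i> * of_real (- 2 * pi * real m * (x \<bullet> b)))"
    unfolding exp_add[symmetric]
    by (rule arg_cong[of _ _ exp]) (simp add: cdot_simps algebra_simps inner_add_left inner_add_right inner_commute)
  have "Phi \<tau> (a + x) (b + y) = exp (pi * \<i> * of_nat m * of_real (a \<bullet> a) * \<tau>)
       * (exp (pi * \<i> * of_nat m * (of_real (x \<bullet> x) * \<tau> + 2 * cdot (cvec x) ?z))
           * \<phi> (\<tau>, ?z + \<tau> *s cvec x + cvec y))
       * exp (\<i> * of_real (- 2 * pi * real m * (x \<bullet> b)))"
    unfolding Phi_def arg ex by (simp only: ac_simps)
  also have "\<dots> = Phi \<tau> a b * exp (\<i> * of_real (- 2 * pi * real m * (x \<bullet> b)))"
    using elliptic[OF assms(1,2), of \<tau> ?z] assms(3) by (simp add: Phi_def upper_half_plane_def)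
  finally show ?thesis by (simp only: norm_mult norm_exp_i_times mult_1_right)
qed

lemma Phi_T:
  assumes "Im \<tau> > 0"
  shows "norm (Phi (\<tau> + 1) a b) = norm (Phi \<tau> a (a + b))"
proof -
  have "\<phi> (\<tau> + 1, z) = \<phi> (\<tau>, z)" for z
    using modular[of 1 1 1 0 \<tau> z] assms by (simp add: upper_half_plane_def)
  moreover have "(\<tau> + 1) *s cvec a + cvec b = \<tau> *s cvec a + cvec (a + b)"
    by (simp add: cvec_add vector_sadd_rdistrib)
  moreover have "exp (pi * \<i> * of_nat m * of_real (a \<bullet> a) * (\<tau> + 1))
    = exp (pi * \<i> * of_nat m * of_real (a \<bullet> a) * \<tau>) * exp (\<i> * of_real (pi * real m * (a \<bullet> a)))"
    unfolding exp_add[symmetric] by (rule arg_cong[of _ _ exp]) (simp add: algebra_simps)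
  ultimately show ?thesis
    unfolding Phi_def by (simp only: norm_mult norm_exp_i_times mult_1_right)
qed

text \<open>For \<open>z = b * \<tau> - a\<close>, the exponent of the modular law cancels the
  Gaussian factor of \<open>a\<close> at \<open>- 1 / \<tau>\<close> and leaves that of
  \<open>b\<close> at \<open>\<tau>\<close>, up to a phase.\<close>

lemma Phi_S:
  assumes "Im \<tau> > 0"
  shows "norm (Phi (- 1 / \<tau>) a b) = norm \<tau> ^ k * norm (Phi \<tau> b (- a))"
proof -
  have \<tau>: "\<tau> \<noteq> 0" using assms by auto
  let ?z = "\<tau> *s cvec b + cvec (- a)"
  have arg: "(- 1 / \<tau>) *s cvec a + cvec b = (1 / \<tau>) *s ?z"
    using \<tau> by (simp add: vec_eq_iff cvec_def field_simps)
  have "\<tau> powi (- int k) * exp (- (pi * \<i> * of_nat m * (cdot ?z ?z / \<tau>))) * \<phi> (- 1 / \<tau>, (1 / \<tau>) *s ?z)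
      = \<phi> (\<tau>, ?z)"
    using modular[of 0 0 "-1" 1 \<tau> ?z] assms by (simp add: upper_half_plane_def)
  then have eq: "\<phi> (- 1 / \<tau>, (1 / \<tau>) *s ?z) = \<tau> ^ k * exp (pi * \<i> * of_nat m * (cdot ?z ?z / \<tau>)) * \<phi> (\<tau>, ?z)"
    using \<tau> by (auto simp: power_int_minus exp_minus field_simps)
  have "pi * \<i> * of_nat m * of_real (a \<bullet> a) * (- 1 / \<tau>) + pi * \<i> * of_nat m * (cdot ?z ?z / \<tau>)
     = pi * \<i> * of_nat m * of_real (b \<bullet> b) * \<tau> + \<i> * of_real (- 2 * pi * real m * (a \<bullet> b))"
    using \<tau> by (simp add: cdot_simps inner_commute field_simps power2_eq_square)
  from arg_cong[OF this, of exp]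
  have "exp (pi * \<i> * of_nat m * of_real (a \<bullet> a) * (- 1 / \<tau>)) * exp (pi * \<i> * of_nat m * (cdot ?z ?z / \<tau>))
     = exp (pi * \<i> * of_nat m * of_real (b \<bullet> b) * \<tau>) * exp (\<i> * of_real (- 2 * pi * real m * (a \<bullet> b)))"
    by (simp only: exp_add)
  note ex = this
  have "Phi (- 1 / \<tau>) a b = \<tau> ^ k * (exp (pi * \<i> * of_nat m * of_real (a \<bullet> a) * (- 1 / \<tau>))
       * exp (pi * \<i> * of_nat m * (cdot ?z ?z / \<tau>))) * \<phi> (\<tau>, ?z)"
    unfolding Phi_def arg eq by (simp only: ac_simps)
  then have "Phi (- 1 / \<tau>) a b = \<tau> ^ k * Phi \<tau> b (- a) * exp (\<i> * of_real (- 2 * pi * real m * (a \<bullet> b)))"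
    unfolding ex Phi_def[of \<tau>] by (simp only: ac_simps)
  then show ?thesis by (simp only: norm_mult norm_power norm_exp_i_times mult_1_right)
qed

lemma continuous_Phi:
  "continuous_on ({\<tau>. Im \<tau> > 0} \<times> UNIV) (\<lambda>(\<tau>, a, b). Phi \<tau> a b)"
proof -
  have "continuous_on ({\<tau>. Im \<tau> > 0} \<times> UNIV)
      (\<lambda>p. \<phi> (fst p, fst p *s cvec (fst (snd p)) + cvec (snd (snd p))))"
    by (rule continuous_on_compose2[OF continuous_on_holomorphic_jac[OF holomorphic]])
       (auto intro!: continuous_intros simp: upper_half_plane_def)
  then show ?thesis
    unfolding Phi_def case_prod_unfold by (intro continuous_intros)
qed

lemma holomorphic_Phi: "(\<lambda>\<tau>. Phi \<tau> a b) holomorphic_on {\<tau>. Im \<tau> > 0}"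
proof -
  have "(\<lambda>\<tau>. \<phi> (1 * \<tau> + 0, \<tau> *s cvec a + cvec b)) holomorphic_on {\<tau>. Im \<tau> > 0}"
    by (rule holomorphic_on_line[OF holomorphic]) (simp add: upper_half_plane_def)
  then show ?thesis unfolding Phi_def by (auto intro!: holomorphic_intros)
qed

section \<open>Growth and decay read off the Fourier expansion\<close>

lemma abs_summable_coefficients:
  assumes "y > 0"
  shows "(\<lambda>(n, l). norm (f n l) * exp (- 2 * pi * y * real n)) summable_on (UNIV \<times> dual_lattice L)"
proof -
  let ?t = "\<lambda>(n, l). f n l * exp (2 * pi * \<i> * (\<i> * of_real y)) ^ n * exp (2 * pi * \<i> * cdot (cvec l) 0)"
  have "(?t has_sum \<phi> (\<i> * of_real y, 0)) (UNIV \<times> dual_lattice L)"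
    using expansion assms unfolding fourier_expansion_def upper_half_plane_def by simp
  then have "?t summable_on (UNIV \<times> dual_lattice L)" by (rule has_sum_imp_summable)
  then have "(\<lambda>p. norm (?t p)) summable_on (UNIV \<times> dual_lattice L)"
    by (simp add: summable_on_iff_abs_summable_on_complex)
  moreover have "norm (?t (n, l)) = norm (f n l) * exp (- 2 * pi * y * real n)" for n l
    by (simp add: cdot_def norm_mult norm_power exp_of_nat_mult[symmetric] algebra_simps)
  ultimately show ?thesis by (simp add: case_prod_unfold)
qed

definition majorant :: "real \<Rightarrow> real" where
  "majorant y = (\<Sum>\<^sub>\<infinity>(n, l)\<in>UNIV \<times> dual_lattice L. norm (f n l) * exp (- 2 * pi * y * real n))"

lemma majorant_nonneg: "majorant y \<ge> 0"
  unfolding majorant_def by (intro infsum_nonneg) auto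

lemma support_bound: "f n l \<noteq> 0 \<Longrightarrow> l \<bullet> l \<le> 2 * real n * real m"
  using expansion unfolding fourier_expansion_def by blast

text \<open>Termwise comparison: the term (n, l) of \<open>Phi\<close> has norm
  \<open>norm (f n l)\<close> times exp(-2 pi Im(\<open>\<tau>\<close>) E) with E = n + l.a + m a.a
  / 2. Bounding \<open>Phi\<close> thus amounts to bounding E below on the support of
  \<open>f\<close>.\<close>

lemma Phi_le_majorant:
  assumes y: "y > 0" and \<tau>: "Im \<tau> > 0"
    and le: "\<And>n l. f n l \<noteq> 0 \<Longrightarrow> 2 * pi * y * real n \<le> 2 * pi * Im \<tau> * (real n + l \<bullet> a + real m * (a \<bullet> a) / 2) + \<kappa>"
  shows "norm (Phi \<tau> a b) \<le> exp \<kappa> * majorant y"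
proof -
  let ?z = "\<tau> *s cvec a + cvec b" and ?I = "UNIV \<times> dual_lattice L :: (nat \<times> (real ^ 'n)) set"
  let ?t = "\<lambda>(n, l). exp (pi * \<i> * of_nat m * of_real (a \<bullet> a) * \<tau>) *
      (f n l * exp (2 * pi * \<i> * \<tau>) ^ n * exp (2 * pi * \<i> * cdot (cvec l) ?z))"
  have "(?t has_sum Phi \<tau> a b) ?I"
  proof -
    have "((\<lambda>(n, l). f n l * exp (2 * pi * \<i> * \<tau>) ^ n * exp (2 * pi * \<i> * cdot (cvec l) ?z))
        has_sum \<phi> (\<tau>, ?z)) ?I"
      using expansion \<tau> unfolding fourier_expansion_def upper_half_plane_def by blast
    from has_sum_cmult_right[OF this] show ?thesis
      unfolding Phi_def by (simp add: case_prod_unfold)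
  qed
  moreover have "((\<lambda>(n, l). exp \<kappa> * (norm (f n l) * exp (- 2 * pi * y * real n))) has_sum exp \<kappa> * majorant y) ?I"
    using has_sum_cmult_right[OF has_sum_infsum[OF abs_summable_coefficients[OF y]], of "exp \<kappa>"]
    unfolding majorant_def by (simp add: case_prod_unfold)
  moreover have "norm (?t p) \<le> (\<lambda>(n, l). exp \<kappa> * (norm (f n l) * exp (- 2 * pi * y * real n))) p" for p
  proof (cases p)
    case (Pair n l)
    have "norm (?t (n, l)) = norm (f n l) * exp (- 2 * pi * Im \<tau> * (real n + l \<bullet> a + real m * (a \<bullet> a) / 2))"
      by (simp add: norm_mult norm_power exp_of_nat_mult[symmetric] cdot_simps exp_add[symmetric] algebra_simps)
    also have "\<dots> \<le> norm (f n l) * exp (\<kappa> - 2 * pi * y * real n)"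
      using le[of n l] by (cases "f n l = 0") auto
    also have "\<dots> = exp \<kappa> * (norm (f n l) * exp (- 2 * pi * y * real n))"
      by (simp add: exp_diff exp_minus field_simps)
    finally show ?thesis using Pair by simp
  qed
  ultimately show ?thesis by (rule norm_infsum_le)
qed

text \<open>Cauchy-Schwarz with the support condition. Each application chooses \<open>u\<close> so
  that the last hypothesis becomes the nonnegativity of a square or a product.\<close>

lemma inner_bound:
  assumes "f n l \<noteq> 0" "u \<ge> 0" "2 * real n * real m * (a \<bullet> a) \<le> u\<^sup>2"
  shows "- u \<le> l \<bullet> a"
proof -
  have "(l \<bullet> a)\<^sup>2 \<le> (l \<bullet> l) * (a \<bullet> a)" by (rule Cauchy_Schwarz_ineq)
  also have "\<dots> \<le> 2 * real n * real m * (a \<bullet> a)"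
    by (intro mult_right_mono support_bound assms(1)) simp
  finally have "(l \<bullet> a)\<^sup>2 \<le> u\<^sup>2" using assms(3) by simp
  then have "\<bar>l \<bullet> a\<bar> \<le> \<bar>u\<bar>" by (simp only: abs_le_square_iff)
  then show ?thesis using assms(2) by simp
qed

lemma Phi_bounded:
  assumes y0: "y0 > 0"
  shows "\<exists>A\<ge>0. \<forall>\<tau> a b. Im \<tau> \<ge> y0 \<longrightarrow> norm a \<le> r \<longrightarrow> norm (Phi \<tau> a b) \<le> A"
proof (intro exI conjI allI impI)
  \<comment> \<open>Half of the height \<open>y0\<close> is kept for convergence of the majorant;
    the exponential pays for the loss \<open>m * r\<^sup>2 / 2\<close> in the lower bound of the
    exponent.\<close>
  show "0 \<le> exp (pi * y0 * real m * r\<^sup>2) * majorant (y0 / 2)" using majorant_nonneg by simp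
  fix \<tau> :: complex and a b :: "real ^ 'n" assume \<tau>: "Im \<tau> \<ge> y0" and a: "norm a \<le> r"
  show "norm (Phi \<tau> a b) \<le> exp (pi * y0 * real m * r\<^sup>2) * majorant (y0 / 2)"
  proof (rule Phi_le_majorant)
    fix n l assume nz: "f n l \<noteq> 0"
    let ?t = "real m * (a \<bullet> a)" and ?E = "real n + l \<bullet> a + real m * (a \<bullet> a) / 2"
    have aa: "a \<bullet> a \<le> r\<^sup>2" using a power_mono[OF a, of 2] by (simp add: power2_norm_eq_inner)
    \<comment> \<open>This choice makes the exponent \<open>?E\<close> nonnegative, which permits
      replacing \<open>Im \<tau>\<close> by \<open>y0\<close> below.\<close>
    have "- (real n + ?t / 2) \<le> l \<bullet> a"
    proof (rule inner_bound[OF nz])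
      have "(real n + ?t / 2)\<^sup>2 - 2 * real n * real m * (a \<bullet> a) = (real n - ?t / 2)\<^sup>2"
        by (simp add: power2_eq_square field_simps)
      then show "2 * real n * real m * (a \<bullet> a) \<le> (real n + ?t / 2)\<^sup>2"
        using zero_le_power2[of "real n - ?t / 2"] by linarith
    qed simp
    then have E0: "?E \<ge> 0" by simp
    \<comment> \<open>The rebalanced choice sacrifices a multiple of \<open>a \<bullet> a\<close>
      but keeps \<open>n / 2\<close>, on which the sum over \<open>n\<close> relies.\<close>
    have "- (real n / 2 + ?t) \<le> l \<bullet> a"
    proof (rule inner_bound[OF nz])
      have "(real n / 2 + ?t)\<^sup>2 - 2 * real n * real m * (a \<bullet> a) = (real n / 2 - ?t)\<^sup>2"
        by (simp add: power2_eq_square field_simps)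
      then show "2 * real n * real m * (a \<bullet> a) \<le> (real n / 2 + ?t)\<^sup>2"
        using zero_le_power2[of "real n / 2 - ?t"] by linarith
    qed simp
    then have "real n / 2 - ?t / 2 \<le> ?E" by simp
    moreover have "?t \<le> real m * r\<^sup>2" using aa by (intro mult_left_mono) auto
    ultimately have "real n / 2 - real m * r\<^sup>2 / 2 \<le> ?E" by simp
    then have "y0 * (real n / 2 - real m * r\<^sup>2 / 2) \<le> y0 * ?E" using y0 by (intro mult_left_mono) auto
    also have "\<dots> \<le> Im \<tau> * ?E" using E0 \<tau> by (intro mult_right_mono)
    finally have "2 * pi * (y0 * (real n / 2 - real m * r\<^sup>2 / 2)) \<le> 2 * pi * (Im \<tau> * ?E)"
      by (intro mult_left_mono) auto
    then show "2 * pi * (y0 / 2) * real n \<le> 2 * pi * Im \<tau> * ?E + pi * y0 * real m * r\<^sup>2"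
      by (simp add: algebra_simps)
  qed (use y0 \<tau> in auto)
qed

text \<open>On the support, \<open>n \<ge> R \<ge> m\<close>; with
  \<open>a \<bullet> a \<le> 1 / 2\<close> this forces an exponent of at least \<open>n / 4\<close>.
  The part \<open>y0\<close> of the height serves convergence, and the rest gives decay because
  \<open>n \<ge> R\<close>.\<close>

lemma Phi_decay:
  assumes y0: "y0 > 0" and vanish: "\<And>n l. n < R \<Longrightarrow> f n l = 0" and "m \<le> R"
  shows "\<exists>A\<ge>0. \<forall>\<tau> a b. Im \<tau> \<ge> y0 \<longrightarrow> a \<bullet> a \<le> 1 / 2 \<longrightarrow>
           norm (Phi \<tau> a b) \<le> A * exp (- (pi / 2 * real R * (Im \<tau> - y0)))"
proof (intro exI conjI allI impI)
  show "0 \<le> majorant (y0 / 4)" by (rule majorant_nonneg)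
  fix \<tau> :: complex and a b :: "real ^ 'n" assume \<tau>: "Im \<tau> \<ge> y0" and a: "a \<bullet> a \<le> 1 / 2"
  have "norm (Phi \<tau> a b) \<le> exp (- (pi / 2 * real R * (Im \<tau> - y0))) * majorant (y0 / 4)"
  proof (rule Phi_le_majorant)
    fix n l assume nz: "f n l \<noteq> 0"
    have n: "R \<le> n" using vanish[of n l] nz by (meson not_le)
    let ?t = "real m * (a \<bullet> a)" and ?E = "real n + l \<bullet> a + real m * (a \<bullet> a) / 2"
    have "?t \<le> real n * (1 / 2)" using a n \<open>m \<le> R\<close> by (intro mult_mono) auto
    then have t: "?t \<le> real n / 2" by simp
    \<comment> \<open>The choice yields exactly \<open>?E \<ge> n / 4\<close>. The difference to be
      checked has the roots \<open>n / 2\<close> and \<open>9 * n / 2\<close> in \<open>?t\<close>,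
      and \<open>?t\<close> does not exceed the smaller one.\<close>
    have "- (3 / 4 * real n + ?t / 2) \<le> l \<bullet> a"
    proof (rule inner_bound[OF nz])
      have "(3 / 4 * real n + ?t / 2)\<^sup>2 - 2 * real n * real m * (a \<bullet> a)
          = (real n / 2 - ?t) * (9 / 2 * real n - ?t) / 4"
        by (simp add: power2_eq_square field_simps)
      moreover have "(real n / 2 - ?t) * (9 / 2 * real n - ?t) \<ge> 0"
        using t by (intro mult_nonneg_nonneg) auto
      ultimately have "0 \<le> (3 / 4 * real n + ?t / 2)\<^sup>2 - 2 * real n * real m * (a \<bullet> a)" by simp
      then show "2 * real n * real m * (a \<bullet> a) \<le> (3 / 4 * real n + ?t / 2)\<^sup>2"
        by (simp only: diff_ge_0_iff_ge)
    qed simp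
    then have "real n / 4 \<le> ?E" by simp
    then have "Im \<tau> * (real n / 4) \<le> Im \<tau> * ?E" using \<tau> y0 by (intro mult_left_mono) auto
    moreover have "(Im \<tau> - y0) * (real R / 4) \<le> (Im \<tau> - y0) * (real n / 4)"
      using \<tau> n by (intro mult_left_mono) auto
    moreover have "y0 / 4 * real n + (Im \<tau> - y0) * (real n / 4) = Im \<tau> * (real n / 4)"
      by (simp add: field_simps)
    ultimately have "y0 / 4 * real n + (Im \<tau> - y0) * (real R / 4) \<le> Im \<tau> * ?E"
      by linarith
    then have "2 * pi * (y0 / 4 * real n + (Im \<tau> - y0) * (real R / 4)) \<le> 2 * pi * (Im \<tau> * ?E)"
      by (intro mult_left_mono) auto
    then show "2 * pi * (y0 / 4) * real n \<le> 2 * pi * Im \<tau> * ?E + - (pi / 2 * real R * (Im \<tau> - y0))"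
      by (simp add: field_simps)
  qed (use y0 \<tau> in auto)
  then show "norm (Phi \<tau> a b) \<le> majorant (y0 / 4) * exp (- (pi / 2 * real R * (Im \<tau> - y0)))"
    by (simp add: mult.commute)
qed

end

section \<open>The vanishing theorem\<close>

locale torus_invariant = lattice_basis L B for L B :: "(real ^ 'n) set" +
  fixes M :: "complex \<Rightarrow> real ^ 'n \<Rightarrow> real ^ 'n \<Rightarrow> real"
  assumes per: "\<And>\<tau> a b x y. Im \<tau> > 0 \<Longrightarrow> x \<in> L \<Longrightarrow> y \<in> L \<Longrightarrow> M \<tau> (a + x) (b + y) = M \<tau> a b"
    and T: "\<And>\<tau> a b. Im \<tau> > 0 \<Longrightarrow> M (\<tau> + 1) a b = M \<tau> a (a + b)"
begin

lemma translate_Re: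
  assumes "Im \<tau> > 0"
  shows "\<exists>b'. M (\<tau> + of_int j) a b' = M \<tau> a b"
proof -
  have nat: "M (\<tau> + of_nat i) a b = M \<tau> a (real i *\<^sub>R a + b)" if "Im \<tau> > 0" for \<tau> i b
  proof (induction i arbitrary: b)
    case (Suc i)
    have "M (\<tau> + of_nat (Suc i)) a b = M ((\<tau> + of_nat i) + 1) a b" by (simp add: ac_simps)
    also have "\<dots> = M (\<tau> + of_nat i) a (a + b)" using that by (intro T) simp
    also have "\<dots> = M \<tau> a (real i *\<^sub>R a + (a + b))" by (rule Suc)
    finally show ?case by (simp add: algebra_simps)
  qed simp
  show ?thesis
  proof (cases j rule: int_cases2)
    case (nonneg i)
    have "M (\<tau> + of_nat i) a (b - real i *\<^sub>R a) = M \<tau> a b" using nat[OF assms] by simp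
    then show ?thesis using nonneg by auto
  next
    case (nonpos i)
    have "M ((\<tau> - of_nat i) + of_nat i) a b = M (\<tau> - of_nat i) a (real i *\<^sub>R a + b)"
      by (rule nat) (use assms in simp)
    then show ?thesis using nonpos by (intro exI[of _ "real i *\<^sub>R a + b"]) simp
  qed
qed

text \<open>Integer translations of \<open>\<tau>\<close> alter only \<open>b\<close>, so lattice
  shifts made afterwards can still bring both real coordinates into a bounded range.\<close>

lemma reduce:
  assumes \<tau>: "Im \<tau> > 0"
  shows "\<exists>\<tau>' a' b'. Im \<tau>' = Im \<tau> \<and> \<bar>Re \<tau>'\<bar> \<le> 1 / 2 \<and> norm a' \<le> radius \<and> norm b' \<le> radius
           \<and> M \<tau>' a' b' = M \<tau> a b"
proof -
  let ?\<tau>' = "\<tau> + of_int (- round (Re \<tau>))"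
  obtain b' where b': "M ?\<tau>' a b' = M \<tau> a b" using translate_Re[OF \<tau>] by blast
  obtain x where x: "x \<in> L" "norm (a - x) \<le> radius" using covering by blast
  obtain y where y: "y \<in> L" "norm (b' - y) \<le> radius" using covering by blast
  have "M ?\<tau>' (a + - x) (b' + - y) = M ?\<tau>' a b'"
    using \<tau> x y by (intro per L_uminus) auto
  moreover have "\<bar>Re ?\<tau>'\<bar> \<le> 1 / 2" using of_int_round_abs_le[of "Re \<tau>"] by (simp add: abs_minus_commute)
  ultimately show ?thesis using b' x(2) y(2) by (intro exI[of _ ?\<tau>'] exI[of _ "a - x"] exI[of _ "b' - y"]) simp
qed

lemma descent:
  assumes S: "\<And>\<tau> a b. Im \<tau> > 0 \<Longrightarrow> M (- 1 / \<tau>) a b = M \<tau> b (- a)"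
    and \<tau>: "Im \<tau> > 0"
  shows "\<exists>\<tau>' a' b'. Im \<tau>' \<ge> 1 / 2 \<and> M \<tau>' a' b' = M \<tau> a b"
proof -
  have "\<exists>\<tau>' a' b'. Im \<tau>' \<ge> 1 / 2 \<and> M \<tau>' a' b' = M \<tau> a b" if "Im \<tau> \<ge> (1 / 2) ^ Suc j" for \<tau> a b j
    using that
  proof (induction j arbitrary: \<tau> a b)
    case (Suc j)
    have "0 < Im \<tau>" using Suc.prems zero_less_power[of "1 / 2 :: real" "Suc (Suc j)"] by linarith
    then obtain \<tau>1 a1 b1 where r: "Im \<tau>1 = Im \<tau>" "\<bar>Re \<tau>1\<bar> \<le> 1 / 2" "M \<tau>1 a1 b1 = M \<tau> a b"
      using reduce[of \<tau> a b] by blast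
    show ?case
    proof (cases "Im \<tau>1 \<ge> 1 / 2")
      case False
      have pos: "0 < Im \<tau>1" using r(1) \<open>0 < Im \<tau>\<close> by simp
      have "(Re \<tau>1)\<^sup>2 \<le> (1 / 2)\<^sup>2" using r(2) by (intro abs_le_square_iff[THEN iffD1]) simp
      moreover have "(Im \<tau>1)\<^sup>2 \<le> (1 / 2)\<^sup>2" using False pos by (intro power_mono) auto
      ultimately have le: "(Re \<tau>1)\<^sup>2 + (Im \<tau>1)\<^sup>2 \<le> 1 / 2" by (simp add: power2_eq_square)
      have pos2: "0 < (Re \<tau>1)\<^sup>2 + (Im \<tau>1)\<^sup>2" using pos by (simp add: add_nonneg_pos)
      have "Im (- 1 / \<tau>1) = Im \<tau>1 / ((Re \<tau>1)\<^sup>2 + (Im \<tau>1)\<^sup>2)" by (simp add: Im_divide)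
      moreover have "2 * Im \<tau>1 * ((Re \<tau>1)\<^sup>2 + (Im \<tau>1)\<^sup>2) \<le> 2 * Im \<tau>1 * (1 / 2)"
        using le pos by (intro mult_left_mono) auto
      ultimately have "2 * Im \<tau>1 \<le> Im (- 1 / \<tau>1)" using pos2 by (simp add: pos_le_divide_eq)
      then have "(1 / 2) ^ Suc j \<le> Im (- 1 / \<tau>1)" using Suc.prems r(1) by simp
      from Suc.IH[OF this, of "- b1" a1] show ?thesis using S[OF pos, of "- b1" a1] r(3) by simp
    qed (use r in blast)
  qed auto
  moreover obtain j where "(1 / 2 :: real) ^ j < Im \<tau>" using real_arch_pow_inv[OF \<tau>, of "1 / 2"] by auto
  then have "(1 / 2) ^ Suc j \<le> Im \<tau>" using \<tau> by simp
  ultimately show ?thesis by blast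
qed

text \<open>The positive value at \<open>\<tau>1\<close> fixes a height \<open>Y\<close> above which
  nothing competes; between \<open>c\<close> and \<open>Y\<close>, \<open>reduce\<close> moves every
  point into a compact set.\<close>

lemma attains_sup:
  assumes cont: "continuous_on ({\<tau>. Im \<tau> > 0} \<times> UNIV) (\<lambda>(\<tau>, a, b). M \<tau> a b)"
    and decay: "\<And>\<epsilon>. \<epsilon> > 0 \<Longrightarrow> \<exists>Y. \<forall>\<tau> a b. Im \<tau> \<ge> Y \<longrightarrow> M \<tau> a b < \<epsilon>"
    and c: "c > 0" and pos: "Im \<tau>1 \<ge> c" "M \<tau>1 a1 b1 > 0"
  shows "\<exists>\<tau>0 a0 b0. Im \<tau>0 \<ge> c \<and> (\<forall>\<tau> a b. Im \<tau> \<ge> c \<longrightarrow> M \<tau> a b \<le> M \<tau>0 a0 b0)"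
proof -
  obtain Y where Y: "\<And>\<tau> a b. Im \<tau> \<ge> Y \<Longrightarrow> M \<tau> a b < M \<tau>1 a1 b1" using decay[OF pos(2)] by blast
  define K where "K = cbox (Complex (- 1 / 2) c) (Complex (1 / 2) Y) \<times> cball (0 :: real ^ 'n) radius \<times> cball (0 :: real ^ 'n) radius"
  have red: "\<exists>\<tau>' a' b'. (\<tau>', a', b') \<in> K \<and> M \<tau>' a' b' = M \<tau> a b" if \<tau>: "c \<le> Im \<tau>" "Im \<tau> \<le> Y" for \<tau> a b
  proof -
    have "0 < Im \<tau>" using \<tau> c by linarith
    then obtain \<tau>' a' b' where "Im \<tau>' = Im \<tau>" "\<bar>Re \<tau>'\<bar> \<le> 1 / 2" "norm a' \<le> radius" "norm b' \<le> radius"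
        "M \<tau>' a' b' = M \<tau> a b"
      using reduce[of \<tau> a b] by blast
    then show ?thesis using \<tau>
      by (intro exI[of _ \<tau>'] exI[of _ a'] exI[of _ b']) (auto simp: K_def in_cbox_complex_iff)
  qed
  have Y1: "Im \<tau>1 \<le> Y" using Y[of \<tau>1 a1 b1] by force
  have "compact K" unfolding K_def by (intro compact_Times compact_cbox compact_cball)
  moreover have "K \<noteq> {}" using red[OF pos(1) Y1] by blast
  moreover have "continuous_on K (\<lambda>(\<tau>, a, b). M \<tau> a b)"
    by (rule continuous_on_subset[OF cont]) (use c in \<open>auto simp: K_def in_cbox_complex_iff\<close>)
  ultimately obtain p where p: "p \<in> K" "\<And>q. q \<in> K \<Longrightarrow> (\<lambda>(\<tau>, a, b). M \<tau> a b) q \<le> (\<lambda>(\<tau>, a, b). M \<tau> a b) p"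
    using continuous_attains_sup by metis
  obtain \<tau>0 a0 b0 where p0: "p = (\<tau>0, a0, b0)" by (cases p)
  have le: "M \<tau> a b \<le> M \<tau>0 a0 b0" if \<tau>: "c \<le> Im \<tau>" "Im \<tau> \<le> Y" for \<tau> a b
  proof -
    obtain \<tau>' a' b' where "(\<tau>', a', b') \<in> K" "M \<tau>' a' b' = M \<tau> a b" using red[OF \<tau>] by blast
    then show ?thesis using p(2)[of "(\<tau>', a', b')"] p0 by simp
  qed
  have "M \<tau> a b \<le> M \<tau>0 a0 b0" if "c \<le> Im \<tau>" for \<tau> a b
  proof (cases "Im \<tau> \<le> Y")
    case False
    then have "M \<tau> a b < M \<tau>1 a1 b1" by (intro Y) simp
    then show ?thesis using le[OF pos(1) Y1, of a1 b1] by simp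
  qed (use that le in blast)
  moreover have "c \<le> Im \<tau>0" using p(1) p0 by (auto simp: K_def in_cbox_complex_iff)
  ultimately show ?thesis by blast
qed

end

section \<open>Exponential decay against powers, and density of nonzeros\<close>

lemma power_mult_exp_tendsto_0:
  fixes \<delta> :: real
  assumes "\<delta> > 0"
  shows "((\<lambda>y. y ^ K * exp (- (\<delta> * y))) \<longlongrightarrow> 0) at_top"
proof -
  have "filterlim (\<lambda>y. \<delta> * y) at_top at_top"
    using assms by (intro filterlim_tendsto_pos_mult_at_top[OF tendsto_const] filterlim_ident)
  from filterlim_compose[OF tendsto_power_div_exp_0 this, of K]
  have "((\<lambda>y. (1 / \<delta>) ^ K * ((\<delta> * y) ^ K / exp (\<delta> * y))) \<longlongrightarrow> (1 / \<delta>) ^ K * 0) at_top"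
    by (intro tendsto_mult tendsto_const)
  moreover have "(1 / \<delta>) ^ K * ((\<delta> * y) ^ K / exp (\<delta> * y)) = y ^ K * exp (- (\<delta> * y))" for y
    using assms by (simp add: power_mult_distrib power_divide exp_minus field_simps)
  ultimately show ?thesis by simp
qed

text \<open>The nonzero set of \<open>g\<close> is open, and dense by the identity theorem, so
  finitely many of its translates meet in every ball.\<close>

lemma open_dense_product_nonzero:
  fixes g :: "complex ^ 'n \<Rightarrow> complex"
  assumes "finite W" and cont: "continuous_on UNIV g"
    and hol: "\<And>v w. (\<lambda>x. g (x *s v + w)) holomorphic_on UNIV"
    and nz: "g z1 \<noteq> 0" and "e > 0"
  shows "\<exists>z'. dist z z' < e \<and> (\<forall>w\<in>W. g (z' + w) \<noteq> 0)"
  using assms(1) \<open>e > 0\<close>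
proof (induction W arbitrary: z e rule: finite_induct)
  case empty
  then show ?case by (intro exI[of _ z]) simp
next
  case (insert w W)
  have dense: "\<exists>z'. dist u z' < e \<and> g z' \<noteq> 0" for u
  proof (rule ccontr)
    assume con: "\<nexists>z'. dist u z' < e \<and> g z' \<noteq> 0"
    \<comment> \<open>The complex line through \<open>u\<close> at parameter 0 and \<open>z1\<close>
      at parameter 1: vanishing near \<open>u\<close> would spread to \<open>z1\<close>.\<close>
    let ?h = "\<lambda>x. g (x *s (z1 - u) + u)"
    have "continuous_on UNIV (\<lambda>x::complex. x *s (z1 - u) + u)" by (intro continuous_intros)
    then have "\<forall>\<^sub>F x in at 0. dist ((x::complex) *s (z1 - u) + u) u < e"
      using insert.prems by (auto simp: continuous_on_eq_continuous_at isCont_def dest!: spec[of _ 0] tendstoD)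
    then obtain d where d: "d > 0" "\<And>x. x \<noteq> 0 \<Longrightarrow> dist x 0 < d \<Longrightarrow> dist ((x::complex) *s (z1 - u) + u) u < e"
      unfolding eventually_at by auto
    have "?h 1 = 0"
    proof (rule analytic_continuation[of ?h UNIV "ball 0 d" 0])
      show "(0 :: complex) islimpt ball 0 d" using d(1) by (simp add: islimpt_ball)
      show "?h x = 0" if "x \<in> ball 0 d" for x
      proof (cases "x = 0")
        case True
        then show ?thesis using con insert.prems by auto
      next
        case False
        then show ?thesis using con d(2)[of x] that by (auto simp: dist_commute)
      qed
    qed (use hol[of "z1 - u" u] in \<open>simp_all add: connected_UNIV\<close>)
    then show False using nz by simp
  qed
  obtain u where u: "dist (z + w) u < e" "g u \<noteq> 0" using dense by blast
  have "open {z. g (z + w) \<noteq> 0}"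
    by (intro open_Collect_neq continuous_on_compose2[OF cont] continuous_intros) auto
  then obtain d where d: "d > 0" "\<And>y. dist y (u - w) < d \<Longrightarrow> g (y + w) \<noteq> 0"
    using openE[of "{z. g (z + w) \<noteq> 0}" "u - w"] u(2) by (auto simp: subset_iff dist_commute)
  have zu: "dist z (u - w) < e" using u(1) by (simp add: dist_norm algebra_simps)
  obtain z' where z': "dist (u - w) z' < min d (e - dist z (u - w))" "\<forall>w\<in>W. g (z' + w) \<noteq> 0"
    using insert.IH[of "min d (e - dist z (u - w))" "u - w"] d(1) zu by auto
  have "dist z z' < e" using z'(1) dist_triangle[of z z' "u - w"] by simp
  moreover have "g (z' + w) \<noteq> 0" using d(2)[of z'] z'(1) by (simp add: dist_commute)
  ultimately show ?case using z'(2) by blast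
qed


section \<open>The product of translates over the grid\<close>

context jacobi_form
begin

definition Phi_prod :: "nat \<Rightarrow> complex \<Rightarrow> real ^ 'n \<Rightarrow> real ^ 'n \<Rightarrow> complex" where
  "Phi_prod N \<tau> a b = (\<Prod>s\<in>grid N. \<Prod>t\<in>grid N. Phi \<tau> (a + s) (b + t))"

lemma norm_Phi_prod: "norm (Phi_prod N \<tau> a b) = (\<Prod>s\<in>grid N. \<Prod>t\<in>grid N. norm (Phi \<tau> (a + s) (b + t)))"
  by (simp add: Phi_prod_def prod_norm)

lemma Phi_prod_translate:
  assumes "Im \<tau> > 0" "x \<in> L" "y \<in> L"
  shows "norm (Phi_prod N \<tau> (a + x) (b + y)) = norm (Phi_prod N \<tau> a b)"
  unfolding norm_Phi_prod
proof (intro prod.cong refl)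
  fix s t
  show "norm (Phi \<tau> (a + x + s) (b + y + t)) = norm (Phi \<tau> (a + s) (b + t))"
    using Phi_translate[OF assms(2,3,1), of "a + s" "b + t"] by (simp add: ac_simps)
qed

lemma norm_Phi_translate_left: "Im \<tau> > 0 \<Longrightarrow> x \<in> L \<Longrightarrow> norm (Phi \<tau> (a + x) b) = norm (Phi \<tau> a b)"
  using Phi_translate[OF _ L_zero, of x \<tau> a b] by simp

lemma norm_Phi_translate_right: "Im \<tau> > 0 \<Longrightarrow> y \<in> L \<Longrightarrow> norm (Phi \<tau> a (b + y)) = norm (Phi \<tau> a b)"
  using Phi_translate[OF L_zero, of y \<tau> a b] by simp

text \<open>The translation adds \<open>a + s\<close> to the second argument; the grid point
  \<open>s\<close> merely permutes the factors indexed by \<open>t\<close>.\<close>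

lemma Phi_prod_T:
  assumes N: "N > 0" and \<tau>: "Im \<tau> > 0"
  shows "norm (Phi_prod N (\<tau> + 1) a b) = norm (Phi_prod N \<tau> a (a + b))"
  unfolding norm_Phi_prod
proof (rule prod.cong[OF refl])
  fix s assume s: "s \<in> grid N"
  have "(\<Prod>t\<in>grid N. norm (Phi (\<tau> + 1) (a + s) (b + t)))
      = (\<Prod>t\<in>grid N. norm (Phi \<tau> (a + s) ((a + b) + (s + t))))"
    by (simp add: Phi_T[OF \<tau>] add.assoc add.left_commute[of s b])
  also have "\<dots> = (\<Prod>t\<in>grid N. norm (Phi \<tau> (a + s) (a + b + t)))"
  proof (rule grid_prod_shift[OF N, where g = "\<lambda>v. norm (Phi \<tau> (a + s) (a + b + v))"])
    fix v x assume "x \<in> L"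
    then show "norm (Phi \<tau> (a + s) (a + b + (v + x))) = norm (Phi \<tau> (a + s) (a + b + v))"
      using norm_Phi_translate_right[OF \<tau>, of x "a + s" "a + b + v"] by (simp add: add.assoc)
  qed (rule grid_scale[OF N s])
  finally show "(\<Prod>t\<in>grid N. norm (Phi (\<tau> + 1) (a + s) (b + t)))
      = (\<Prod>t\<in>grid N. norm (Phi \<tau> (a + s) (a + b + t)))" .
qed

text \<open>Inversion exchanges the two grids and negates one of them, which rearranges the product.
  Each of the \<open>card (grid N) ^ 2\<close> factors contributes weight \<open>k\<close>.\<close>

lemma Phi_prod_S:
  assumes N: "N > 0" and \<tau>: "Im \<tau> > 0"
  shows "norm (Phi_prod N (- 1 / \<tau>) a b) = norm \<tau> ^ (k * card (grid N) ^ 2) * norm (Phi_prod N \<tau> b (- a))"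
proof -
  have "norm (Phi_prod N (- 1 / \<tau>) a b)
      = (\<Prod>s\<in>grid N. \<Prod>t\<in>grid N. norm \<tau> ^ k * norm (Phi \<tau> (b + t) (- a + - s)))"
    unfolding norm_Phi_prod Phi_S[OF \<tau>] by simp
  also have "\<dots> = norm \<tau> ^ (k * card (grid N) ^ 2)
      * (\<Prod>s\<in>grid N. \<Prod>t\<in>grid N. norm (Phi \<tau> (b + t) (- a + - s)))"
    by (simp add: prod.distrib power_mult[symmetric] power2_eq_square mult.assoc)
  also have "(\<Prod>s\<in>grid N. \<Prod>t\<in>grid N. norm (Phi \<tau> (b + t) (- a + - s)))
      = (\<Prod>t\<in>grid N. \<Prod>s\<in>grid N. norm (Phi \<tau> (b + t) (- a + - s)))"
    by (rule prod.swap)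
  also have "\<dots> = (\<Prod>t\<in>grid N. \<Prod>s\<in>grid N. norm (Phi \<tau> (b + t) (- a + s)))"
  proof (rule prod.cong[OF refl], rule grid_prod_uminus[OF N])
    fix t v x assume "x \<in> L"
    then show "norm (Phi \<tau> (b + t) (- a + (v + x))) = norm (Phi \<tau> (b + t) (- a + v))"
      using norm_Phi_translate_right[OF \<tau>, of x "b + t" "- a + v"] by (simp only: add.assoc)
  qed
  finally show ?thesis unfolding norm_Phi_prod .
qed

lemma continuous_Phi_prod:
  "continuous_on ({\<tau>. Im \<tau> > 0} \<times> UNIV) (\<lambda>(\<tau>, a, b). Phi_prod N \<tau> a b)"
  unfolding Phi_prod_def case_prod_unfold
proof (intro continuous_on_prod)
  fix s t
  have "continuous_on ({\<tau>. Im \<tau> > 0} \<times> UNIV)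
      (\<lambda>p. (\<lambda>(\<tau>, a, b). Phi \<tau> a b) (fst p, fst (snd p) + s, snd (snd p) + t))"
    by (rule continuous_on_compose2[OF continuous_Phi]) (auto intro!: continuous_intros)
  then show "continuous_on ({\<tau>. Im \<tau> > 0} \<times> UNIV)
      (\<lambda>p. Phi (fst p) (fst (snd p) + s) (snd (snd p) + t))" by simp
qed

lemma holomorphic_Phi_prod: "(\<lambda>\<tau>. Phi_prod N \<tau> a b) holomorphic_on {\<tau>. Im \<tau> > 0}"
  unfolding Phi_prod_def by (intro holomorphic_on_prod holomorphic_Phi)

text \<open>
  Every translate of the grid meets the neighbourhood of \<open>L\<close> in which \<open>Phi\<close> has exponential decay.
\<close>

lemma Phi_prod_decay:
  assumes N: "N > 0" "(radius / real N)\<^sup>2 \<le> 1 / 2"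
    and vanish: "\<And>n l. n < R \<Longrightarrow> f n l = 0" and "m \<le> R"
  shows "\<exists>A. \<forall>\<tau> a b. Im \<tau> \<ge> 1 \<longrightarrow>
           norm (Phi_prod N \<tau> a b) \<le> A * exp (- (pi / 2 * real R * real (card (grid N)) * Im \<tau>))"
proof -
  obtain A1 where A1: "\<And>\<tau> a b. Im \<tau> \<ge> 1 \<Longrightarrow> norm a \<le> radius \<Longrightarrow> norm (Phi \<tau> a b) \<le> A1"
    using Phi_bounded[of 1 radius] by auto
  obtain A2 where A2: "\<And>\<tau> a b. Im \<tau> \<ge> 1 \<Longrightarrow> a \<bullet> a \<le> 1 / 2 \<Longrightarrow>
      norm (Phi \<tau> a b) \<le> A2 * exp (- (pi / 2 * real R * (Im \<tau> - 1)))"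
    using Phi_decay[of 1 R, OF _ vanish \<open>m \<le> R\<close>] by auto
  define A where "A = max A1 A2"
  let ?d = "card (grid N)"
  have "norm (Phi_prod N \<tau> a b) \<le> (A ^ (?d ^ 2) * exp (pi / 2 * real R * real ?d)) * exp (- (pi / 2 * real R * real ?d * Im \<tau>))"
    if \<tau>: "Im \<tau> \<ge> 1" for \<tau> a b
  proof -
    have \<tau>0: "Im \<tau> > 0" using \<tau> by simp
    define E where "E = exp (- (pi / 2 * real R * (Im \<tau> - 1)))"
    \<comment> \<open>Only the \<open>card (grid N)\<close> factors with \<open>s = s0\<close> are
      known to decay; the others are just bounded. Hence the decay rate carries one power of the
      grid size, the weight two.\<close>
    obtain s0 x0 where s0: "s0 \<in> grid N" "x0 \<in> L" "norm (a + s0 + x0) \<le> radius / N"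
      using grid_covering[OF N(1), of a] by blast
    have le: "norm (Phi \<tau> (a + s) (b + t)) \<le> A * (if s = s0 then E else 1)" for s t
    proof (cases "s = s0")
      case True
      have "(norm (a + s0 + x0))\<^sup>2 \<le> (radius / real N)\<^sup>2" using s0(3) by (intro power_mono) auto
      then have "(a + s0 + x0) \<bullet> (a + s0 + x0) \<le> 1 / 2" using N(2) by (simp add: power2_norm_eq_inner)
      from A2[OF \<tau> this, of "b + t"] have "norm (Phi \<tau> (a + s0) (b + t)) \<le> A2 * E"
        using norm_Phi_translate_left[OF \<tau>0 s0(2)] by (simp add: E_def)
      also have "\<dots> \<le> A * E" by (intro mult_right_mono) (auto simp: A_def E_def)
      finally show ?thesis using True by simp
    next
      case False
      obtain x where x: "x \<in> L" "norm (a + s - x) \<le> radius" using covering by blast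
      have "norm (Phi \<tau> (a + s) (b + t)) \<le> A1"
        using A1[OF \<tau> x(2), of "b + t"] norm_Phi_translate_left[OF \<tau>0 L_uminus[OF x(1)], of "a + s" "b + t"] by simp
      then show ?thesis using False by (simp add: A_def)
    qed
    have "norm (Phi_prod N \<tau> a b) \<le> (\<Prod>s\<in>grid N. \<Prod>t\<in>grid N. A * (if s = s0 then E else 1))"
      unfolding norm_Phi_prod by (intro prod_mono conjI prod_nonneg ballI le) auto
    also have "\<dots> = (\<Prod>s\<in>grid N. A ^ ?d * (if s = s0 then E ^ ?d else 1))"
      by (intro prod.cong refl) (simp add: power_mult_distrib)
    also have "\<dots> = A ^ (?d ^ 2) * E ^ ?d"
      using s0(1) finite_grid by (simp add: prod.distrib power_mult[symmetric] power2_eq_square)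
    also have "E ^ ?d = exp (pi / 2 * real R * real ?d) * exp (- (pi / 2 * real R * real ?d * Im \<tau>))"
      unfolding E_def exp_of_nat_mult[symmetric] exp_add[symmetric] by (simp add: field_simps)
    finally show ?thesis by (simp only: mult.assoc)
  qed
  then show ?thesis by blast
qed

text \<open>Grid translates of \<open>(a, b)\<close> shift \<open>z\<close> by finitely many
  vectors, so density yields a \<open>z\<close> at which no factor vanishes; its real coordinates
  exist because \<open>Im \<tau> > 0\<close>.\<close>

lemma Phi_prod_nonzero:
  assumes "\<phi> \<noteq> 0"
  shows "\<exists>\<tau> a b. Im \<tau> > 0 \<and> Phi_prod N \<tau> a b \<noteq> 0"
proof -
  obtain \<tau> z1 where nz: "\<phi> (\<tau>, z1) \<noteq> 0" using assms by (auto simp: fun_eq_iff)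
  then have \<tau>: "\<tau> \<in> upper_half_plane" using jac unfolding jacobi_forms_def by blast
  then have Im: "Im \<tau> > 0" by (simp add: upper_half_plane_def)
  define g where "g z = \<phi> (\<tau>, z)" for z
  define w :: "(real ^ 'n) \<times> (real ^ 'n) \<Rightarrow> complex ^ 'n" where "w = (\<lambda>(s, t). \<tau> *s cvec s + cvec t)"
  have "continuous_on UNIV g"
    unfolding g_def by (rule continuous_on_compose2[OF continuous_on_holomorphic_jac[OF holomorphic]])
      (auto intro!: continuous_intros \<tau>)
  moreover have "(\<lambda>x. g (x *s v + u)) holomorphic_on UNIV" for v u
    using holomorphic_on_line[OF holomorphic, of UNIV 0 \<tau> v u] \<tau> by (simp add: g_def)
  ultimately obtain z where z: "\<And>u. u \<in> w ` (grid N \<times> grid N) \<Longrightarrow> g (z + u) \<noteq> 0"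
    using open_dense_product_nonzero[of "w ` (grid N \<times> grid N)" g z1 1 0] nz finite_grid
    unfolding g_def by (metis finite_cartesian_product finite_imageI zero_less_one)
  define a where "a = (\<chi> i. Im (z $ i) / Im \<tau>)"
  define b where "b = (\<chi> i. Re (z $ i) - Re \<tau> * a $ i)"
  have zab: "z = \<tau> *s cvec a + cvec b"
    using Im by (simp add: vec_eq_iff complex_eq_iff cvec_def a_def b_def)
  have "Phi \<tau> (a + s) (b + t) \<noteq> 0" if "s \<in> grid N" "t \<in> grid N" for s t
  proof -
    have "\<tau> *s cvec (a + s) + cvec (b + t) = z + w (s, t)"
      unfolding zab w_def by (simp add: cvec_add vector_add_ldistrib algebra_simps)
    then show ?thesis using z[of "w (s, t)"] that by (simp add: Phi_def g_def)
  qed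
  then have "Phi_prod N \<tau> a b \<noteq> 0" unfolding Phi_prod_def using finite_grid by simp
  then show ?thesis using Im by blast
qed


text \<open>The invariant \<open>F\<close> is maximal at some height \<open>2 * c\<close>. On
  descending to height \<open>c\<close>, the maximum principle forces \<open>Phi_prod\<close> to
  grow by exp(\<open>\<beta> * c\<close>), whereas maximality of \<open>F\<close> lets its square
  grow at most by \<open>2 ^ K\<close>.\<close>

lemma vanishing:
  assumes N: "N > 0" "(radius / real N)\<^sup>2 \<le> 1 / 2"
    and vanish: "\<And>n l. n < R \<Longrightarrow> f n l = 0" and "m \<le> R" and large: "3 * k * card (grid N) < R"
  shows "\<phi> = 0"
proof (rule ccontr)
  assume "\<phi> \<noteq> 0"
  define d where "d = card (grid N)"
  define K where "K = k * d ^ 2"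
  \<comment> \<open>Half of the decay rate of \<open>Phi_prod\<close>, so that \<open>G\<close>
    still decays after the factor exp(\<open>\<beta> * Im \<tau>\<close>).\<close>
  define \<beta> where "\<beta> = pi / 4 * real R * real d"
  have d: "d > 0" unfolding d_def using grid_nonempty[OF N(1)] finite_grid by (simp add: card_gt_0_iff)
  have R: "R > 0" using large by simp
  have \<beta>: "\<beta> > 0" unfolding \<beta>_def using d R by simp
  obtain A where A: "\<And>\<tau> a b. Im \<tau> \<ge> 1 \<Longrightarrow> norm (Phi_prod N \<tau> a b) \<le> A * exp (- (2 * \<beta> * Im \<tau>))"
    using Phi_prod_decay[OF N vanish \<open>m \<le> R\<close>] unfolding \<beta>_def d_def by (auto simp: algebra_simps)
  obtain \<tau>p ap bp where p: "Im \<tau>p > 0" "Phi_prod N \<tau>p ap bp \<noteq> 0" using Phi_prod_nonzero[OF \<open>\<phi> \<noteq> 0\<close>] by blast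
  define F where "F \<tau> a b = (norm (Phi_prod N \<tau> a b))\<^sup>2 * Im \<tau> ^ K" for \<tau> a b
  define G where "G \<tau> a b = norm (Phi_prod N \<tau> a b) * exp (\<beta> * Im \<tau>)" for \<tau> a b
  interpret F: torus_invariant L B F
    by unfold_locales (simp_all add: F_def Phi_prod_translate Phi_prod_T[OF N(1)])
  interpret G: torus_invariant L B G
    by unfold_locales (simp_all add: G_def Phi_prod_translate Phi_prod_T[OF N(1)])
  have contP: "continuous_on ({\<tau>. Im \<tau> > 0} \<times> UNIV) (\<lambda>p. Phi_prod N (fst p) (fst (snd p)) (snd (snd p)))"
    using continuous_Phi_prod[of N] by (simp add: case_prod_unfold)
  have contF: "continuous_on ({\<tau>. Im \<tau> > 0} \<times> UNIV) (\<lambda>(\<tau>, a, b). F \<tau> a b)"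
    unfolding F_def case_prod_unfold by (intro continuous_intros contP)
  have contG: "continuous_on ({\<tau>. Im \<tau> > 0} \<times> UNIV) (\<lambda>(\<tau>, a, b). G \<tau> a b)"
    unfolding G_def case_prod_unfold by (intro continuous_intros contP)
  have F_S: "F (- 1 / \<tau>) a b = F \<tau> b (- a)" if \<tau>: "Im \<tau> > 0" for \<tau> a b
  proof -
    have nz: "norm \<tau> \<noteq> 0" using \<tau> by auto
    have "Im (- 1 / \<tau>) = Im \<tau> / (norm \<tau>)\<^sup>2" by (simp add: Im_divide cmod_power2)
    then have "F (- 1 / \<tau>) a b = (norm \<tau> ^ K * norm (Phi_prod N \<tau> b (- a)))\<^sup>2 * (Im \<tau> / (norm \<tau>)\<^sup>2) ^ K"
      unfolding F_def Phi_prod_S[OF N(1) \<tau>] K_def d_def by simp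
    also have "\<dots> = F \<tau> b (- a)"
      unfolding F_def using nz
      by (simp add: power_mult_distrib power_divide power_mult[symmetric] mult.commute)
    finally show ?thesis .
  qed
  have decayF: "\<exists>Y. \<forall>\<tau> a b. Im \<tau> \<ge> Y \<longrightarrow> F \<tau> a b < \<epsilon>" if \<epsilon>: "\<epsilon> > 0" for \<epsilon>
  proof -
    have "((\<lambda>y. A\<^sup>2 * (y ^ K * exp (- (4 * \<beta> * y)))) \<longlongrightarrow> A\<^sup>2 * 0) at_top"
      using \<beta> by (intro tendsto_mult tendsto_const power_mult_exp_tendsto_0) simp
    then have "\<forall>\<^sub>F y in at_top. A\<^sup>2 * (y ^ K * exp (- (4 * \<beta> * y))) < \<epsilon>"
      using \<epsilon> by (intro order_tendstoD(2)) auto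
    then obtain Y where Y: "\<And>y. y \<ge> Y \<Longrightarrow> A\<^sup>2 * (y ^ K * exp (- (4 * \<beta> * y))) < \<epsilon>"
      unfolding eventually_at_top_linorder by blast
    have "F \<tau> a b < \<epsilon>" if "Im \<tau> \<ge> max 1 Y" for \<tau> a b
    proof -
      have "(norm (Phi_prod N \<tau> a b))\<^sup>2 \<le> (A * exp (- (2 * \<beta> * Im \<tau>)))\<^sup>2"
        using A[of \<tau> a b] that by (intro power_mono) auto
      then have "F \<tau> a b \<le> (A * exp (- (2 * \<beta> * Im \<tau>)))\<^sup>2 * Im \<tau> ^ K"
        unfolding F_def using that by (intro mult_right_mono) auto
      also have "\<dots> = A\<^sup>2 * (Im \<tau> ^ K * exp (- (4 * \<beta> * Im \<tau>)))"
        by (simp add: power_mult_distrib exp_double[symmetric] algebra_simps)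
      finally show ?thesis using Y[of "Im \<tau>"] that by simp
    qed
    then show ?thesis by blast
  qed
  have decayG: "\<exists>Y. \<forall>\<tau> a b. Im \<tau> \<ge> Y \<longrightarrow> G \<tau> a b < \<epsilon>" if \<epsilon>: "\<epsilon> > 0" for \<epsilon>
  proof -
    have "((\<lambda>y. A * (y ^ 0 * exp (- (\<beta> * y)))) \<longlongrightarrow> A * 0) at_top"
      using \<beta> by (intro tendsto_mult tendsto_const power_mult_exp_tendsto_0)
    then have "\<forall>\<^sub>F y in at_top. A * (y ^ 0 * exp (- (\<beta> * y))) < \<epsilon>"
      using \<epsilon> by (intro order_tendstoD(2)) auto
    then obtain Y where Y: "\<And>y. y \<ge> Y \<Longrightarrow> A * exp (- (\<beta> * y)) < \<epsilon>"
      unfolding eventually_at_top_linorder by auto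
    have "G \<tau> a b < \<epsilon>" if "Im \<tau> \<ge> max 1 Y" for \<tau> a b
    proof -
      have "G \<tau> a b \<le> (A * exp (- (2 * \<beta> * Im \<tau>))) * exp (\<beta> * Im \<tau>)"
        unfolding G_def using A[of \<tau> a b] that by (intro mult_right_mono) auto
      also have "\<dots> = A * exp (- (\<beta> * Im \<tau>))"
        by (simp add: mult.assoc exp_add[symmetric])
      finally show ?thesis using Y[of "Im \<tau>"] that by simp
    qed
    then show ?thesis by blast
  qed
  have "F \<tau>p ap bp > 0" unfolding F_def using p by simp
  moreover obtain \<tau>q aq bq where q: "Im \<tau>q \<ge> 1 / 2" "F \<tau>q aq bq = F \<tau>p ap bp"
    using F.descent[OF F_S p(1)] by blast
  ultimately have "F \<tau>q aq bq > 0" by simp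
  from F.attains_sup[OF contF decayF half_gt_zero[OF zero_less_one] q(1) this] obtain \<tau>0 a0 b0
    where \<tau>0: "Im \<tau>0 \<ge> 1 / 2" and max0: "\<And>\<tau> a b. Im \<tau> \<ge> 1 / 2 \<Longrightarrow> F \<tau> a b \<le> F \<tau>0 a0 b0"
    by blast
  \<comment> \<open>Maximality is needed at all heights, since the point \<open>\<tau>1\<close>
    found below may lie lower than 1/2.\<close>
  have maxF: "F \<tau> a b \<le> F \<tau>0 a0 b0" if "Im \<tau> > 0" for \<tau> a b
    using F.descent[OF F_S that] max0 by metis
  have "F \<tau>0 a0 b0 > 0" using \<open>F \<tau>q aq bq > 0\<close> max0[OF q(1), of aq bq] by linarith
  then have P0: "norm (Phi_prod N \<tau>0 a0 b0) > 0" unfolding F_def by auto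
  define c where "c = Im \<tau>0 / 2"
  have c: "c > 0" "c \<le> Im \<tau>0" using \<tau>0 by (auto simp: c_def)
  have G0: "G \<tau>0 a0 b0 > 0" using P0 by (simp add: G_def)
  obtain \<tau>1 a1 b1 where \<tau>1: "Im \<tau>1 \<ge> c" and maxG: "\<And>\<tau> a b. Im \<tau> \<ge> c \<Longrightarrow> G \<tau> a b \<le> G \<tau>1 a1 b1"
    using G.attains_sup[OF contG decayG c(1) c(2) G0] by blast
  have G1: "G \<tau>1 a1 b1 > 0" using maxG[OF c(2), of a0 b0] G0 by linarith
  \<comment> \<open>At an interior maximum the holomorphic \<open>h\<close>, whose norm is
    \<open>G\<close>, would be constant on the half plane, against the decay of
    \<open>G\<close>.\<close>
  have "Im \<tau>1 = c"
  proof (rule ccontr)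
    assume "Im \<tau>1 \<noteq> c"
    then have in1: "\<tau>1 \<in> {\<tau>. Im \<tau> > c}" using \<tau>1 by simp
    define h where "h \<tau> = Phi_prod N \<tau> a1 b1 * exp (- (\<i> * of_real \<beta> * \<tau>))" for \<tau>
    have norm_h: "norm (h \<tau>) = G \<tau> a1 b1" for \<tau> by (simp add: h_def G_def norm_mult)
    have "h constant_on {\<tau>. Im \<tau> > c}"
    proof (rule maximum_modulus_principle[OF _ _ _ _ subset_refl in1])
      show "h holomorphic_on {\<tau>. Im \<tau> > c}"
        unfolding h_def
        by (intro holomorphic_intros holomorphic_on_subset[OF holomorphic_Phi_prod]) (use c in auto)
      show "connected {\<tau>. Im \<tau> > c}"
        by (intro convex_connected convex_halfspace_Im_gt)
      show "norm (h z) \<le> norm (h \<tau>1)" if "z \<in> {\<tau>. Im \<tau> > c}" for z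
        using maxG[of z a1 b1] that by (simp add: norm_h)
    qed (auto intro: open_halfspace_Im_gt)
    then have const: "norm (h \<tau>) = G \<tau>1 a1 b1" if "Im \<tau> > c" for \<tau>
      using in1 that norm_h unfolding constant_on_def by (metis mem_Collect_eq)
    obtain Y where "\<And>\<tau> a b. Im \<tau> \<ge> Y \<Longrightarrow> G \<tau> a b < G \<tau>1 a1 b1" using decayG[OF G1] by blast
    from this[of "\<i> * of_real (max Y (c + 1))" a1 b1] const[of "\<i> * of_real (max Y (c + 1))"] norm_h
    show False by (simp add: less_max_iff_disj)
  qed
  define u where "u = norm (Phi_prod N \<tau>0 a0 b0)"
  define v where "v = norm (Phi_prod N \<tau>1 a1 b1)"
  \<comment> \<open>The two maxima are compared: \<open>\<tau>0\<close> has height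
    \<open>2 * c\<close>, \<open>\<tau>1\<close> has height \<open>c\<close>.\<close>
  have "u * exp (\<beta> * (2 * c)) \<le> v * exp (\<beta> * c)"
    using maxG[OF c(2), of a0 b0] \<open>Im \<tau>1 = c\<close> by (simp add: G_def u_def v_def c_def)
  then have "u * exp (\<beta> * c) * exp (\<beta> * c) \<le> v * exp (\<beta> * c)"
    by (simp add: exp_double power2_eq_square algebra_simps exp_add[symmetric])
  then have uv: "u * exp (\<beta> * c) \<le> v" by simp
  have "v\<^sup>2 * c ^ K \<le> u\<^sup>2 * (2 * c) ^ K"
    using maxF[of \<tau>1 a1 b1] \<open>Im \<tau>1 = c\<close> c(1) by (simp add: F_def u_def v_def c_def)
  then have "v\<^sup>2 * c ^ K \<le> (u\<^sup>2 * 2 ^ K) * c ^ K" by (simp add: power_mult_distrib mult.assoc)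
  then have vu: "v\<^sup>2 \<le> u\<^sup>2 * 2 ^ K" using c(1) by simp
  have u: "u > 0" using P0 by (simp add: u_def)
  have "(u * exp (\<beta> * c))\<^sup>2 \<le> v\<^sup>2" using uv u by (intro power_mono) auto
  with vu have "u\<^sup>2 * exp (2 * (\<beta> * c)) \<le> u\<^sup>2 * 2 ^ K"
    by (simp add: power_mult_distrib exp_double)
  then have "exp (2 * (\<beta> * c)) \<le> 2 ^ K" using u by simp
  also have "\<dots> \<le> exp 1 ^ K" using exp_ge_add_one_self[of 1] by (intro power_mono) auto
  also have "\<dots> = exp (real K)" by (simp add: exp_of_nat_mult[symmetric])
  finally have "2 * (\<beta> * c) \<le> real K" by simp
  \<comment> \<open>Here \<open>c \<ge> 1 / 4\<close>, because \<open>\<tau>0\<close> has height at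
    least 1/2.\<close>
  moreover have "\<beta> * (1 / 2) \<le> 2 * (\<beta> * c)" using \<beta> \<tau>0 by (simp add: c_def)
  ultimately have "\<beta> / 2 \<le> real K" by simp
  then have "pi * real R * real d \<le> 8 * (real k * real d) * real d"
    by (simp add: \<beta>_def K_def power2_eq_square)
  then have "pi * real R \<le> 8 * (real k * real d)" using d by simp
  \<comment> \<open>Thus \<open>3 * R \<le> 8 * k * d\<close>, while \<open>large\<close> gives
    \<open>9 * k * d < 3 * R\<close>.\<close>
  moreover have "3 * real R \<le> pi * real R" using pi_gt3 by (intro mult_right_mono) auto
  ultimately have "3 * real R \<le> 8 * (real k * real d)" by linarith
  moreover have "real (3 * k * d) < real R" using large unfolding d_def of_nat_less_iff .
  then have "3 * (real k * real d) < real R" by simp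
  moreover have "0 \<le> real k * real d" by simp
  ultimately show False by linarith
qed

end

section \<open>Symmetric formal Fourier--Jacobi series\<close>

lemma full_lattice_basis:
  assumes "full_lattice L"
  obtains B where "lattice_basis L B"
  using assms unfolding full_lattice_def lattice_basis_def by blast

definition vanishing_constant :: "(real ^ 'n) set \<Rightarrow> nat \<Rightarrow> bool" where
  "vanishing_constant L C \<longleftrightarrow>
     (\<forall>k m \<phi> f R. \<phi> \<in> jacobi_forms k L m \<longrightarrow> fourier_expansion L m \<phi> f \<longrightarrow>
        (\<forall>n<R. \<forall>l. f n l = 0) \<longrightarrow> m \<le> R \<longrightarrow> C * k < R \<longrightarrow> \<phi> = 0)"

lemma vanishing_constantD:
  assumes "vanishing_constant L C" "\<phi> \<in> jacobi_forms k L m" "fourier_expansion L m \<phi> f"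
    "\<And>n l. n < R \<Longrightarrow> f n l = 0" "m \<le> R" "C * k < R"
  shows "\<phi> = 0"
  using assms unfolding vanishing_constant_def by blast

lemma vanishing_constant_exists:
  fixes L :: "(real ^ 'n) set"
  assumes "full_lattice L"
  shows "\<exists>C. vanishing_constant L C"
proof -
  obtain B where "lattice_basis L B" using full_lattice_basis[OF assms] .
  then interpret lattice_basis L B .
  \<comment> \<open>A mesh with \<open>radius / N \<le> 1 / 2\<close>; the summand 1 keeps
    \<open>N\<close> positive.\<close>
  define N where "N = nat \<lceil>2 * radius\<rceil> + 1"
  have "radius \<ge> 0" unfolding radius_def by (simp add: sum_nonneg)
  have "2 * radius \<le> real N" unfolding N_def by linarith
  then have "radius / real N \<le> 1 / 2" by (simp add: N_def field_simps)
  then have "(radius / real N)\<^sup>2 \<le> (1 / 2)\<^sup>2" using \<open>radius \<ge> 0\<close> by (intro power_mono) auto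
  moreover have "(1 / 2 :: real)\<^sup>2 \<le> 1 / 2" by (simp add: power2_eq_square)
  ultimately have N: "N > 0" "(radius / real N)\<^sup>2 \<le> 1 / 2" by (auto simp: N_def intro: order_trans)
  have "vanishing_constant L (3 * card (grid N))"
    unfolding vanishing_constant_def
  proof (intro allI impI)
    fix k m \<phi> f R
    assume "\<phi> \<in> jacobi_forms k L m" "fourier_expansion L m \<phi> f"
      and R: "\<forall>n<R. \<forall>l. f n l = 0" "m \<le> R" "3 * card (grid N) * k < R"
    then interpret jacobi_form L B k m \<phi> f by unfold_locales
    show "\<phi> = 0" by (rule vanishing[OF N]) (use R in \<open>auto simp: ac_simps\<close>)
  qed
  then show ?thesis ..
qed

lemma formal_FJ_coefficients:
  assumes "\<Psi> \<in> formal_FJ k L"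
  obtains f where "\<And>m. fourier_expansion L m (\<Psi> m) (f m)" "\<And>m n l. f m n l = f n m l"
  using assms unfolding formal_FJ_def by blast

lemma formal_FJ_jacobi: "\<Psi> \<in> formal_FJ k L \<Longrightarrow> \<Psi> m \<in> jacobi_forms_inv k L m"
  unfolding formal_FJ_def by blast

lemma jacobi_forms_inv_subset: "jacobi_forms_inv k L m \<subseteq> jacobi_forms k L m"
  unfolding jacobi_forms_inv_def by blast

text \<open>For \<open>n < m\<close> symmetry turns \<open>f m n l\<close> into a coefficient of
  \<open>\<Psi> n = 0\<close>, which is zero by uniqueness of the expansion.\<close>

lemma formal_FJ_leading_vanish:
  fixes L :: "(real ^ 'n) set"
  assumes "full_lattice L" "\<Psi> \<in> formal_FJ k L" "\<And>i. i < m \<Longrightarrow> \<Psi> i = 0"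
  shows "\<Psi> m \<in> jacobi_forms_inv_vanish k L m m"
proof -
  obtain f where f: "\<And>m. fourier_expansion L m (\<Psi> m) (f m)" "\<And>m n l. f m n l = f n m l"
    using formal_FJ_coefficients[OF assms(2)] by blast
  have "f m n l = 0" if "n < m" for n l
    using fourier_expansion_of_zero[OF assms(1), of n "f n" m l] f(1)[of n] f(2)[of m n l] assms(3)[OF that]
    by simp
  then show ?thesis
    using formal_FJ_jacobi[OF assms(2), of m] f(1)[of m] unfolding jacobi_forms_inv_vanish_def by blast
qed

text \<open>Strong induction: once all earlier coefficients are zero, \<open>\<Psi> m\<close>
  vanishes to order \<open>m\<close>, and \<open>m \<ge> R > C * k\<close> makes the vanishing
  theorem applicable.\<close>

lemma formal_FJ_vanishing:
  fixes L :: "(real ^ 'n) set"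
  assumes full: "full_lattice L" and C: "vanishing_constant L C"
    and \<Psi>: "\<Psi> \<in> formal_FJ k L" and zero: "\<And>i. i < R \<Longrightarrow> \<Psi> i = 0" and R: "C * k < R"
  shows "\<Psi> = 0"
proof -
  have "\<Psi> m = 0" for m
  proof (induction m rule: less_induct)
    case (less m)
    show ?case
    proof (cases "m < R")
      case False
      have "\<Psi> m \<in> jacobi_forms_inv_vanish k L m m"
        by (rule formal_FJ_leading_vanish[OF full \<Psi> less])
      then obtain f where f: "\<Psi> m \<in> jacobi_forms k L m" "fourier_expansion L m (\<Psi> m) f" "\<forall>n<m. \<forall>l. f n l = 0"
        using jacobi_forms_inv_subset unfolding jacobi_forms_inv_vanish_def by blast
      show ?thesis by (rule vanishing_constantD[OF C f(1,2), of m]) (use f(3) R False in auto)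
    qed (rule zero)
  qed
  then show ?thesis by (simp add: fun_eq_iff)
qed

section \<open>Order and slope\<close>

lemma FJ_ord_least: "i < FJ_ord \<Psi> \<Longrightarrow> \<Psi> i = 0"
  unfolding FJ_ord_def using not_less_Least by blast

lemma FJ_ord_nonzero:
  assumes "\<Psi> \<noteq> 0"
  shows "\<Psi> (FJ_ord \<Psi>) \<noteq> 0"
proof -
  have "\<exists>m. \<Psi> m \<noteq> 0"
  proof (rule ccontr)
    assume "\<nexists>m. \<Psi> m \<noteq> 0"
    then have "\<Psi> m = 0" for m by blast
    then have "\<Psi> = 0" by (simp add: fun_eq_iff)
    then show False using assms by contradiction
  qed
  then show ?thesis unfolding FJ_ord_def by (rule LeastI_ex)
qed

text \<open>A nonzero series has order at most \<open>C * k\<close>. Using \<open>Suc C\<close>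
  avoids division by zero for \<open>C = 0\<close>; order 0 gives infinite slope.\<close>

lemma slope_bound_pos:
  fixes L :: "(real ^ 'n) set"
  assumes "full_lattice L"
  shows "slope_bound L > 0"
proof -
  obtain C where C: "vanishing_constant L C" using vanishing_constant_exists[OF assms] ..
  have "ereal (1 / real (Suc C)) \<le> ereal (real k) / ereal (real (FJ_ord \<Psi>))"
    if k: "1 \<le> k" and \<Psi>: "\<Psi> \<in> formal_FJ k L" "\<Psi> \<noteq> 0" for k \<Psi>
  proof (cases "FJ_ord \<Psi> = 0")
    case True
    then show ?thesis using k by (simp add: divide_ereal_def)
  next
    case False
    have "FJ_ord \<Psi> \<le> C * k" 
    proof (rule ccontr)
      assume "\<not> ?thesis"
      then have "\<Psi> = 0"
        by (intro formal_FJ_vanishing[OF assms C \<Psi>(1), of "FJ_ord \<Psi>"] FJ_ord_least) auto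
      then show False using \<Psi>(2) by contradiction
    qed
    then have "real (FJ_ord \<Psi>) \<le> real C * real k" by (metis of_nat_le_iff of_nat_mult)
    also have "\<dots> \<le> real (Suc C) * real k" by (intro mult_right_mono) auto
    finally show ?thesis using False by (simp add: field_simps)
  qed
  then have "ereal (1 / real (Suc C)) \<le> slope_bound L"
    unfolding slope_bound_def by (intro INF_greatest) auto
  moreover have "0 < ereal (1 / real (Suc C))" by simp
  ultimately show ?thesis by (rule less_le_trans[rotated])
qed

lemma FJ_ord_le_slope:
  fixes L :: "(real ^ 'n) set"
  assumes "full_lattice L" "1 \<le> k" "\<Psi> \<in> formal_FJ k L" "\<Psi> \<noteq> 0"
  shows "FJ_ord \<Psi> \<le> nat \<lfloor>real_of_ereal (ereal (real k) / slope_bound L)\<rfloor>"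
proof (cases "FJ_ord \<Psi> = 0")
  case False
  have "slope_bound L \<le> ereal (real k) / ereal (real (FJ_ord \<Psi>))"
    unfolding slope_bound_def
    by (rule INF_lower2[of "(k, \<Psi>)"]) (use assms in auto)
  then have le: "slope_bound L \<le> ereal (real k / real (FJ_ord \<Psi>))" using False by simp
  moreover note pos = slope_bound_pos[OF assms(1)]
  \<comment> \<open>The infimum is a real number: it is positive, and \<open>\<Psi>\<close> itself,
    having positive order, bounds it above.\<close>
  ultimately obtain s where s: "slope_bound L = ereal s" by (cases "slope_bound L") auto
  then have "s > 0" "s \<le> real k / real (FJ_ord \<Psi>)" using le pos by auto
  then have "real (FJ_ord \<Psi>) \<le> real k / s" using False by (simp add: field_simps)
  moreover have "real_of_ereal (ereal (real k) / slope_bound L) = real k / s" using s \<open>s > 0\<close> by simp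
  ultimately show ?thesis by (simp add: le_nat_floor)
qed simp

text \<open>Filtration by order: taking the coefficient of index \<open>j\<close> maps
  \<open>V j\<close> into the forms vanishing to order \<open>j\<close>, with kernel
  \<open>V (Suc j)\<close>.\<close>

lemma edim_formal_FJ_le:
  fixes L :: "(real ^ 'n) set"
  assumes full: "full_lattice L" and zero: "\<And>\<Psi>. \<Psi> \<in> formal_FJ k L \<Longrightarrow> (\<And>i. i \<le> M \<Longrightarrow> \<Psi> i = 0) \<Longrightarrow> \<Psi> = 0"
  shows "edim scale_seq (formal_FJ k L) \<le> (\<Sum>m = 0..M. edim scale_fun (jacobi_forms_inv_vanish k L m m))"
proof -
  interpret V: vector_space scale_seq by (rule vector_space_scale_seq)
  define V where "V j = {\<Psi> \<in> formal_FJ k L. \<forall>i<j. \<Psi> i = 0}" for j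
  have subV: "V.subspace (V j)" for j
  proof (rule subspace_of_lincomb[OF vector_space_scale_seq])
    fix c \<Phi> \<Psi> assume *: "\<Phi> \<in> V j" "\<Psi> \<in> V j"
    then have "scale_seq c \<Phi> + \<Psi> \<in> formal_FJ k L"
      unfolding V_def by (intro V.subspace_add V.subspace_scale subspace_formal_FJ) auto
    with * show "scale_seq c \<Phi> + \<Psi> \<in> V j"
      by (auto simp: V_def scale_seq_def scale_fun_def fun_eq_iff)
  qed (use V.subspace_0[OF subspace_formal_FJ] in \<open>auto simp: V_def\<close>)
  have step: "edim scale_seq (V j) \<le> edim scale_seq (V (Suc j)) + edim scale_fun (jacobi_forms_inv_vanish k L j j)" for j
  proof -
    have "edim scale_seq (V j) \<le> edim scale_seq {\<Psi>\<in>V j. \<Psi> j = 0} + edim scale_fun (jacobi_forms_inv_vanish k L j j)"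
    proof (rule edim_le_kernel[OF vector_space_scale_seq vector_space_scale_fun subV])
      show "(\<lambda>\<Psi>. \<Psi> j) ` V j \<subseteq> jacobi_forms_inv_vanish k L j j"
        using formal_FJ_leading_vanish[OF full] unfolding V_def by blast
    qed (simp add: scale_seq_def)
    moreover have "{\<Psi>\<in>V j. \<Psi> j = 0} = V (Suc j)" by (auto simp: V_def less_Suc_eq)
    ultimately show ?thesis by simp
  qed
  have "edim scale_seq (V 0) \<le> edim scale_seq (V j) + (\<Sum>m<j. edim scale_fun (jacobi_forms_inv_vanish k L m m))" for j
  proof (induction j)
    case (Suc j)
    have "edim scale_seq (V 0) \<le> (edim scale_seq (V (Suc j)) + edim scale_fun (jacobi_forms_inv_vanish k L j j))
        + (\<Sum>m<j. edim scale_fun (jacobi_forms_inv_vanish k L m m))"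
      by (rule order_trans[OF Suc add_right_mono[OF step]])
    then show ?case by (simp add: ac_simps)
  qed simp
  from this[of "Suc M"]
  have "edim scale_seq (V 0) \<le> edim scale_seq (V (Suc M)) + (\<Sum>m<Suc M. edim scale_fun (jacobi_forms_inv_vanish k L m m))" .
  moreover have "V (Suc M) \<subseteq> {0}" using zero unfolding V_def by (auto simp: less_Suc_eq_le)
  then have "edim scale_seq (V (Suc M)) = 0" by (rule edim_zero[OF vector_space_scale_seq])
  moreover have "V 0 = formal_FJ k L" by (simp add: V_def)
  ultimately show ?thesis by (simp add: atLeast0AtMost lessThan_Suc_atMost)
qed

text \<open>Fourier coefficients serve as coordinates. Those with \<open>m, n < R\<close> determine
  each \<open>\<Psi> m\<close> with \<open>m < R\<close> by the vanishing theorem, and these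
  determine the series; the support condition leaves finitely many \<open>l\<close>.\<close>

lemma edim_formal_FJ_growth:
  fixes L :: "(real ^ 'n) set"
  assumes full: "full_lattice L"
  obtains c :: nat where "c > 0" "\<And>k. k \<ge> 1 \<Longrightarrow> edim scale_seq (formal_FJ k L) \<le> enat (c * k ^ (CARD('n) + 2))"
proof -
  obtain B where "lattice_basis L B" using full_lattice_basis[OF full] .
  then interpret lattice_basis L B .
  obtain C where C: "vanishing_constant L C" using vanishing_constant_exists[OF full] ..
  define c where "c = (C + 1) ^ (CARD('n) + 2) * (4 * norm_bound + 1) ^ CARD('n)"
  \<comment> \<open>Uniqueness of the expansion makes this choice canonical, and hence linear in the
    form.\<close>
  define F where "F m \<phi> = (SOME f. fourier_expansion L m \<phi> f)" for m and \<phi> :: "complex \<times> (complex ^ 'n) \<Rightarrow> complex"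
  have F: "F m \<phi> = f" if "fourier_expansion L m \<phi> f" for m \<phi> f
    unfolding F_def using that fourier_expansion_unique[OF full] by (metis someI)
  have FJ: "fourier_expansion L m (\<Psi> m) (F m (\<Psi> m))" if "\<Psi> \<in> formal_FJ k L" for m \<Psi> k
    using formal_FJ_coefficients[OF that] F by metis
  have "edim scale_seq (formal_FJ k L) \<le> enat (c * k ^ (CARD('n) + 2))" if k: "k \<ge> 1" for k
  proof -
    \<comment> \<open>Just above \<open>C * k\<close>: used both as the vanishing order of each form
      and as the number of leading coefficients.\<close>
    define R where "R = C * k + 1"
    have CR: "C * k < R" unfolding R_def by (rule less_add_one)
    \<comment> \<open>For \<open>m, n < R\<close> the support condition gives
      \<open>l \<bullet> l \<le> 2 * n * m < (2 * R)\<^sup>2\<close>, so no nonzero coefficient is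
      missed.\<close>
    define S where "S = {v \<in> dual_lattice L. norm v \<le> real (2 * R)}"
    define I where "I = {..<R} \<times> {..<R} \<times> S"
    have finS: "finite S" and cardS: "card S \<le> (2 * (2 * R) * norm_bound + 1) ^ CARD('n)"
      unfolding S_def by (rule dual_ball)+
    have "edim scale_seq (formal_FJ k L) \<le> enat (card I)"
    proof (rule edim_le_coordinates[where c = "\<lambda>(m, n, l) \<Psi>. F m (\<Psi> m) n l"])
      show "finite I" using finS by (simp add: I_def)
      fix i a \<Phi> \<Psi> assume "i \<in> I" and *: "\<Phi> \<in> formal_FJ k L" "\<Psi> \<in> formal_FJ k L"
      obtain m n l where i: "i = (m, n, l)" by (cases i)
      have "F m ((scale_seq a \<Phi> + \<Psi>) m) = (\<lambda>n l. a * F m (\<Phi> m) n l + F m (\<Psi> m) n l)"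
        using fourier_expansion_lincomb[OF FJ[OF *(1), of m] FJ[OF *(2), of m], where c = a]
        by (intro F) (simp add: scale_seq_def)
      then show "(case i of (m, n, l) \<Rightarrow> \<lambda>\<Psi>. F m (\<Psi> m) n l) (scale_seq a \<Phi> + \<Psi>)
          = a * (case i of (m, n, l) \<Rightarrow> \<lambda>\<Psi>. F m (\<Psi> m) n l) \<Phi> + (case i of (m, n, l) \<Rightarrow> \<lambda>\<Psi>. F m (\<Psi> m) n l) \<Psi>"
        by (simp add: i)
    next
      fix \<Psi> assume \<Psi>: "\<Psi> \<in> formal_FJ k L"
        and zero: "\<And>i. i \<in> I \<Longrightarrow> (case i of (m, n, l) \<Rightarrow> \<lambda>\<Psi>. F m (\<Psi> m) n l) \<Psi> = 0"
      have "\<Psi> m = 0" if m: "m < R" for m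
      proof (rule vanishing_constantD[OF C _ FJ[OF \<Psi>]])
        show "\<Psi> m \<in> jacobi_forms k L m" using formal_FJ_jacobi[OF \<Psi>] jacobi_forms_inv_subset by blast
        show "F m (\<Psi> m) n l = 0" if n: "n < R" for n l
        proof (cases "l \<in> S")
          case True
          then show ?thesis using zero[of "(m, n, l)"] m n by (simp add: I_def)
        next
          case False
          show ?thesis
          proof (cases "l \<in> dual_lattice L")
            case True
            then have "real (2 * R) < norm l" using False by (simp add: S_def)
            then have "(real (2 * R))\<^sup>2 < l \<bullet> l"
              unfolding power2_norm_eq_inner[symmetric] by (intro power_strict_mono) auto
            moreover have "real n * real m \<le> real R * real R" using m n by (intro mult_mono) auto
            moreover have "(real (2 * R))\<^sup>2 = 4 * (real R * real R)" by (simp add: power2_eq_square)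
            ultimately have "2 * real n * real m < l \<bullet> l"
              using zero_le_square[of "real R"] by linarith
            then show ?thesis using FJ[OF \<Psi>, of m] unfolding fourier_expansion_def by (meson not_le)
          next
            case False
            then show ?thesis using FJ[OF \<Psi>, of m] unfolding fourier_expansion_def by blast
          qed
        qed
      qed (use m CR in simp_all)
      then show "\<Psi> = 0" by (rule formal_FJ_vanishing[OF full C \<Psi> _ CR])
    qed (rule vector_space_scale_seq subspace_formal_FJ)+
    also have "card I \<le> c * k ^ (CARD('n) + 2)"
    proof -
      \<comment> \<open>\<open>k \<ge> 1\<close> absorbs the summand 1 of \<open>R\<close>, and
        \<open>R \<ge> 1\<close> that of the ball count.\<close>
      have R: "R \<le> (C + 1) * k" using k by (simp add: R_def)
      have "2 * (2 * R) * norm_bound + 1 \<le> R * (4 * norm_bound + 1)" by (simp add: R_def algebra_simps)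
      then have "card S \<le> (R * (4 * norm_bound + 1)) ^ CARD('n)"
        using cardS power_mono[of _ _ "CARD('n)"] order_trans by (metis le0)
      then have "card I \<le> R * (R * (R * (4 * norm_bound + 1)) ^ CARD('n))"
        by (simp add: I_def card_cartesian_product)
      also have "\<dots> = R ^ (CARD('n) + 2) * (4 * norm_bound + 1) ^ CARD('n)"
        unfolding power_mult_distrib power2_eq_square power_add by (simp only: ac_simps)
      also have "\<dots> \<le> ((C + 1) * k) ^ (CARD('n) + 2) * (4 * norm_bound + 1) ^ CARD('n)"
        using R by (intro mult_right_mono power_mono) auto
      also have "\<dots> = c * k ^ (CARD('n) + 2)" unfolding c_def power_mult_distrib by (simp only: ac_simps)
      finally show ?thesis .
    qed
    finally show ?thesis by simp
  qed
  moreover have "c > 0" by (simp add: c_def)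
  ultimately show ?thesis using that by blast
qed

theorem theorem5p8:
  fixes L :: "(real ^ 'n) set"
  assumes "even_lattice L"
  shows "(\<forall>k\<ge>1.
            edim scale_seq (formal_FJ k L) \<le>
              (\<Sum>m = 0..nat \<lfloor>real_of_ereal (ereal (real k) / slope_bound L)\<rfloor>.
                 edim scale_fun (jacobi_forms_inv_vanish k L m m)) \<and>
            edim scale_seq (formal_FJ k L) < \<infinity>) \<and>
         (\<exists>c :: real. c > 0 \<and>
            (\<forall>k\<ge>1. ereal_of_enat (edim scale_seq (formal_FJ k L)) \<le>
                     ereal (c * real k ^ (CARD('n) + 2))))"
proof -
  have full: "full_lattice L" using assms by (simp add: even_lattice_def)
  obtain c :: nat where c: "c > 0" "\<And>k. k \<ge> 1 \<Longrightarrow> edim scale_seq (formal_FJ k L) \<le> enat (c * k ^ (CARD('n) + 2))"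
    using edim_formal_FJ_growth[OF full] by blast
  show ?thesis
  proof (intro conjI allI impI exI[of _ "real c"])
    fix k :: nat assume k: "k \<ge> 1"
    show "edim scale_seq (formal_FJ k L) \<le>
              (\<Sum>m = 0..nat \<lfloor>real_of_ereal (ereal (real k) / slope_bound L)\<rfloor>.
                 edim scale_fun (jacobi_forms_inv_vanish k L m m))"
    proof (rule edim_formal_FJ_le[OF full], rule ccontr)
      fix \<Psi> assume \<Psi>: "\<Psi> \<in> formal_FJ k L" "\<Psi> \<noteq> 0"
        and zero: "\<And>i. i \<le> nat \<lfloor>real_of_ereal (ereal (real k) / slope_bound L)\<rfloor> \<Longrightarrow> \<Psi> i = 0"
      show False using zero[OF FJ_ord_le_slope[OF full k \<Psi>]] FJ_ord_nonzero[OF \<Psi>(2)] by simp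
    qed
    show "edim scale_seq (formal_FJ k L) < \<infinity>" using c(2)[OF k] by (cases "edim scale_seq (formal_FJ k L)") auto
    have "ereal_of_enat (edim scale_seq (formal_FJ k L)) \<le> ereal_of_enat (enat (c * k ^ (CARD('n) + 2)))"
      using c(2)[OF k] by (simp only: ereal_of_enat_le_iff)
    then show "ereal_of_enat (edim scale_seq (formal_FJ k L)) \<le> ereal (real c * real k ^ (CARD('n) + 2))"
      by simp
  qed (use c(1) in simp)
qed

end
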